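(* Let $\mathcal{H}_1,\mathcal{H}_2$ be complex separable Hilbert spaces, let $A:\operatorname{dom}(A)\subseteq\mathcal{H}_1\to\mathcal{H}_2$ be a densely defined, closed, linear operator with $A^*A\geq\varepsilon I_{\mathcal{H}_1}$ for some $\varepsilon>0$, and let $R$ be a densely defined, closable operator in $\mathcal{H}_1$ with $\operatorname{dom}(R)\supseteq\operatorname{dom}(A)$. Then $Q_{|A|,R}$ is injective and closed, and $$(Q_{|A|,R}-zI_{\mathcal{H}_1\oplus\mathcal{H}_1})^{-1}=\begin{pmatrix}zM(z)^{-1}&|A|^{-1}+M(z)^{-1}(izR+z^2I_{\mathcal{H}_1})|A|^{-1}\\|A|M(z)^{-1}&|A|M(z)^{-1}(iR+zI_{\mathcal{H}_1})|A|^{-1}\end{pmatrix}$$ for all $z\in\rho(Q_{|A|,R})=\{\zeta\in\mathbb{C}\,|\,M(\zeta)^{-1}\in\mathcal{B}(\mathcal{H}_1)\}=\rho(M(\cdot))$, and $$\sigma(Q_{|A|,R})=\sigma(M(\cdot)).$$ In particular, $$Q_{|A|,R}^{-1}=\begin{pmatrix}0&|A|^{-1}\\|A|^{-1}&i\,|A|^{-1}R|A|^{-1}\end{pmatrix}\in\mathcal{B}(\mathcal{H}_1\oplus\mathcal{H}_1),$$ and hence $0\in\rho(Q_{|A|,R})$. Suppose in addition that $R$ is accretive. Then also $i\,Q_{|A|,R}$ is accretive and $-i\,Q_{|A|,R}$ generates a (strongly continuous) contraction semigroup $\exp(-i\,Q_{|A|,R}\,t)$, $t\geq0$, in $\ma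thcal{H}_1\oplus\mathcal{H}_1$.
   Context: $|A|=(A^*A)^{1/2}$, with $\operatorname{dom}(|A|)=\operatorname{dom}(A)$. $\mathcal{B}(\mathcal{H})$ denotes the bounded everywhere defined linear operators on $\mathcal{H}$. $$Q_{|A|,R}=\begin{pmatrix}-iR&|A|\\|A|&0\end{pmatrix},\quad\operatorname{dom}(Q_{|A|,R})=\operatorname{dom}(|A|)\oplus\operatorname{dom}(|A|)\subseteq\mathcal{H}_1\oplus\mathcal{H}_1.$$ The quadratic operator pencil $M(\cdot)$ in $\mathcal{H}_1$ is $M(z)=|A|^2-izR-z^2I_{\mathcal{H}_1}$, $\operatorname{dom}(M(z))=\operatorname{dom}(|A|^2)$, $z\in\mathbb{C}$. Its spectrum and resolvent set are $\sigma(M(\cdot))=\{\lambda\in\mathbb{C}\,|\,0\in\sigma(M(\lambda))\}$ and $\rho(M(\cdot))=\{z\in\mathbb{C}\,|\,0\in\rho(M(z))\}=\mathbb{C}\setminus\sigma(M(\cdot))$. An operator $T$ in $\mathcal{H}$ is accretive if $\operatorname{Re}((f,Tf)_{\mathcal{H}})\geq0$ for all $f\in\operatorname{dom}(T)$. *)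

theory Defs
  imports "HOL-Analysis.Analysis"
begin

(* Complex Hilbert spaces, built on the real ones: the norm and the topology are
   those of the underlying real inner product, which is the real part of cinner.
   As in the context (f, T f), the inner product is linear in its second argument. *)

class complex_inner = real_inner +
  fixes scaleC :: "complex \<Rightarrow> 'a \<Rightarrow> 'a" (infixr "*\<^sub>C" 75)
    and cinner :: "'a \<Rightarrow> 'a \<Rightarrow> complex"
  assumes scaleC_add_right: "c *\<^sub>C (x + y) = c *\<^sub>C x + c *\<^sub>C y"
    and scaleC_add_left: "(c + d) *\<^sub>C x = c *\<^sub>C x + d *\<^sub>C x"
    and scaleC_scaleC: "c *\<^sub>C d *\<^sub>C x = (c * d) *\<^sub>C x"
    and scaleR_scaleC: "r *\<^sub>R x = complex_of_real r *\<^sub>C x"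
    and cinner_commute: "cinner x y = cnj (cinner y x)"
    and cinner_add_right: "cinner x (y + z) = cinner x y + cinner x z"
    and cinner_scaleC_right: "cinner x (c *\<^sub>C y) = c * cinner x y"
    and inner_Re_cinner: "inner x y = Re (cinner x y)"

class chilbert_space = complex_inner + complete_space

instantiation complex :: chilbert_space
begin

definition scaleC_complex :: "complex \<Rightarrow> complex \<Rightarrow> complex" where
  "scaleC_complex c x = c * x"

definition cinner_complex :: "complex \<Rightarrow> complex \<Rightarrow> complex" where
  "cinner_complex x y = cnj x * y"

instance
  by standard
    (simp_all add: scaleC_complex_def cinner_complex_def algebra_simps scaleR_conv_of_real
      inner_complex_def)

end

(* The product type is the orthogonal direct sum: the library's norm on it is the
   Euclidean one. *)

instantiation prod :: (complex_inner, complex_inner) complex_inner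
begin

definition scaleC_prod :: "complex \<Rightarrow> 'a \<times> 'b \<Rightarrow> 'a \<times> 'b" where
  "scaleC_prod c x = (c *\<^sub>C fst x, c *\<^sub>C snd x)"

definition cinner_prod :: "'a \<times> 'b \<Rightarrow> 'a \<times> 'b \<Rightarrow> complex" where
  "cinner_prod x y = cinner (fst x) (fst y) + cinner (snd x) (snd y)"

instance
proof
  fix x y z :: "'a \<times> 'b" and c d :: complex and r :: real
  show "c *\<^sub>C (x + y) = c *\<^sub>C x + c *\<^sub>C y"
    by (simp add: scaleC_prod_def scaleC_add_right)
  show "(c + d) *\<^sub>C x = c *\<^sub>C x + d *\<^sub>C x"
    by (simp add: scaleC_prod_def scaleC_add_left)
  show "c *\<^sub>C d *\<^sub>C x = (c * d) *\<^sub>C x"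
    by (simp add: scaleC_prod_def scaleC_scaleC)
  show "r *\<^sub>R x = complex_of_real r *\<^sub>C x"
    by (simp add: scaleC_prod_def scaleR_prod_def scaleR_scaleC)
  show "cinner x y = cnj (cinner y x)"
    unfolding cinner_prod_def complex_cnj_add
    using cinner_commute[of "fst x" "fst y"] cinner_commute[of "snd x" "snd y"] by simp
  show "cinner x (y + z) = cinner x y + cinner x z"
    by (simp add: cinner_prod_def cinner_add_right)
  show "cinner x (c *\<^sub>C y) = c * cinner x y"
    by (simp add: cinner_prod_def scaleC_prod_def cinner_scaleC_right algebra_simps)
  show "inner x y = Re (cinner x y)"
    by (simp add: cinner_prod_def inner_prod_def inner_Re_cinner)
qed

end

instance prod :: (chilbert_space, chilbert_space) chilbert_space ..

(* A (possibly unbounded) operator is a partial map: T x = None means that x is not in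
   its domain. Equality of operators therefore includes equality of domains, and the
   library's composition of partial maps is composition on the natural domain
   {x \<in> dom T. T x \<in> dom S}. *)

definition linear_op :: "('a::complex_inner \<rightharpoonup> 'b::complex_inner) \<Rightarrow> bool" where
  "linear_op T \<longleftrightarrow>
     T 0 = Some 0 \<and>
     (\<forall>x y u v. T x = Some u \<longrightarrow> T y = Some v \<longrightarrow> T (x + y) = Some (u + v)) \<and>
     (\<forall>c x u. T x = Some u \<longrightarrow> T (c *\<^sub>C x) = Some (c *\<^sub>C u))"

definition densely_defined :: "('a::complex_inner \<rightharpoonup> 'b::complex_inner) \<Rightarrow> bool" where
  "densely_defined T \<longleftrightarrow> closure (dom T) = UNIV"

definition closed_op :: "('a::complex_inner \<rightharpoonup> 'b::complex_inner) \<Rightarrow> bool" where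
  "closed_op T \<longleftrightarrow> closed (Map.graph T)"

definition closable_op :: "('a::complex_inner \<rightharpoonup> 'b::complex_inner) \<Rightarrow> bool" where
  "closable_op T \<longleftrightarrow> (\<exists>S :: 'a \<rightharpoonup> 'b. closure (Map.graph T) = Map.graph S)"

definition bounded_ops :: "('a::complex_inner \<rightharpoonup> 'b::complex_inner) set" where
  "bounded_ops = {T. linear_op T \<and> dom T = UNIV \<and> (\<exists>K. \<forall>x. norm (the (T x)) \<le> K * norm x)}"

abbreviation id_op :: "'a \<rightharpoonup> 'a" where
  "id_op \<equiv> Some"

abbreviation zero_op :: "'a \<rightharpoonup> 'b::zero" where
  "zero_op \<equiv> (\<lambda>_. Some 0)"

definition op_add :: "('a \<rightharpoonup> 'b::complex_inner) \<Rightarrow> ('a \<rightharpoonup> 'b) \<Rightarrow> ('a \<rightharpoonup> 'b)" (infixl "+\<^sub>o" 65)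
  where "S +\<^sub>o T = (\<lambda>x. if x \<in> dom S \<inter> dom T then Some (the (S x) + the (T x)) else None)"

definition op_diff :: "('a \<rightharpoonup> 'b::complex_inner) \<Rightarrow> ('a \<rightharpoonup> 'b) \<Rightarrow> ('a \<rightharpoonup> 'b)" (infixl "-\<^sub>o" 65)
  where "S -\<^sub>o T = (\<lambda>x. if x \<in> dom S \<inter> dom T then Some (the (S x) - the (T x)) else None)"

(* The domain is kept also for c = 0. *)
definition op_scale :: "complex \<Rightarrow> ('a \<rightharpoonup> 'b::complex_inner) \<Rightarrow> ('a \<rightharpoonup> 'b)" (infixr "*\<^sub>o" 75)
  where "c *\<^sub>o T = (\<lambda>x. map_option (scaleC c) (T x))"

(* The block operator matrix with rows (S11, S12) and (S21, S22), on its natural domain. *)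
definition block_op ::
  "('a \<rightharpoonup> 'c::complex_inner) \<Rightarrow> ('b \<rightharpoonup> 'c) \<Rightarrow> ('a \<rightharpoonup> 'd::complex_inner) \<Rightarrow> ('b \<rightharpoonup> 'd) \<Rightarrow>
    ('a \<times> 'b \<rightharpoonup> 'c \<times> 'd)"
  where "block_op S11 S12 S21 S22 =
    (\<lambda>(f, g). if f \<in> dom S11 \<inter> dom S21 \<and> g \<in> dom S12 \<inter> dom S22
       then Some (the (S11 f) + the (S12 g), the (S21 f) + the (S22 g)) else None)"

(* Used below only for graphs that are single-valued. *)
definition op_of_graph :: "('a \<times> 'b) set \<Rightarrow> ('a \<rightharpoonup> 'b)" where
  "op_of_graph G = (\<lambda>x. if \<exists>!y. (x, y) \<in> G then Some (THE y. (x, y) \<in> G) else None)"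

(* The inverse of an injective operator T, with domain the range of T. *)
definition op_inv :: "('a \<rightharpoonup> 'b) \<Rightarrow> ('b \<rightharpoonup> 'a)" where
  "op_inv T = op_of_graph ((Map.graph T)\<inverse>)"

(* The adjoint of a densely defined operator. *)
definition adj :: "('a::complex_inner \<rightharpoonup> 'b::complex_inner) \<Rightarrow> ('b \<rightharpoonup> 'a)" where
  "adj T = op_of_graph {(g, h). \<forall>f\<in>dom T. cinner g (the (T f)) = cinner h f}"

definition selfadjoint :: "('a::complex_inner \<rightharpoonup> 'a) \<Rightarrow> bool" where
  "selfadjoint T \<longleftrightarrow> linear_op T \<and> densely_defined T \<and> adj T = T"

(* T \<ge> 0 in the sense of quadratic forms; T \<ge> c I is expressed as T - c I \<ge> 0. *)
definition nonneg_op :: "('a::complex_inner \<rightharpoonup> 'a) \<Rightarrow> bool" where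
  "nonneg_op T \<longleftrightarrow> (\<forall>f\<in>dom T. cinner f (the (T f)) \<in> \<real> \<and> 0 \<le> Re (cinner f (the (T f))))"

definition accretive :: "('a::complex_inner \<rightharpoonup> 'a) \<Rightarrow> bool" where
  "accretive T \<longleftrightarrow> (\<forall>f\<in>dom T. 0 \<le> Re (cinner f (the (T f))))"

definition op_sqrt :: "('a::complex_inner \<rightharpoonup> 'a) \<Rightarrow> ('a \<rightharpoonup> 'a)" where
  "op_sqrt T = (THE S. selfadjoint S \<and> nonneg_op S \<and> S \<circ>\<^sub>m S = T)"

definition op_abs :: "('a::complex_inner \<rightharpoonup> 'b::complex_inner) \<Rightarrow> ('a \<rightharpoonup> 'a)" where
  "op_abs T = op_sqrt (adj T \<circ>\<^sub>m T)"

definition resolvent_set :: "('a::complex_inner \<rightharpoonup> 'a) \<Rightarrow> complex set" where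
  "resolvent_set T =
     {z. inj_on (T -\<^sub>o z *\<^sub>o id_op) (dom (T -\<^sub>o z *\<^sub>o id_op)) \<and>
         op_inv (T -\<^sub>o z *\<^sub>o id_op) \<in> bounded_ops}"

definition op_spectrum :: "('a::complex_inner \<rightharpoonup> 'a) \<Rightarrow> complex set" where
  "op_spectrum T = - resolvent_set T"

definition pencil_resolvent_set :: "(complex \<Rightarrow> ('a::complex_inner \<rightharpoonup> 'a)) \<Rightarrow> complex set" where
  "pencil_resolvent_set M = {z. 0 \<in> resolvent_set (M z)}"

definition pencil_spectrum :: "(complex \<Rightarrow> ('a::complex_inner \<rightharpoonup> 'a)) \<Rightarrow> complex set" where
  "pencil_spectrum M = {z. 0 \<in> op_spectrum (M z)}"

(* In the next two definitions S stands for |A|. *)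

definition Q_op :: "('a::complex_inner \<rightharpoonup> 'a) \<Rightarrow> ('a \<rightharpoonup> 'a) \<Rightarrow> ('a \<times> 'a \<rightharpoonup> 'a \<times> 'a)" where
  "Q_op S R = block_op ((- \<i>) *\<^sub>o R) S S zero_op"

definition M_pencil :: "('a::complex_inner \<rightharpoonup> 'a) \<Rightarrow> ('a \<rightharpoonup> 'a) \<Rightarrow> complex \<Rightarrow> ('a \<rightharpoonup> 'a)" where
  "M_pencil S R z = (S \<circ>\<^sub>m S) -\<^sub>o (\<i> * z) *\<^sub>o R -\<^sub>o z\<^sup>2 *\<^sub>o id_op"

lemma dom_Q_op: "dom S \<subseteq> dom R \<Longrightarrow> dom (Q_op S R) = dom S \<times> dom S"
  by (auto simp: Q_op_def block_op_def op_scale_def dom_def split: if_splits)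

lemma dom_M_pencil: "dom S \<subseteq> dom R \<Longrightarrow> dom (M_pencil S R z) = dom (S \<circ>\<^sub>m S)"
  by (auto simp: M_pencil_def op_diff_def op_scale_def map_comp_def dom_def
      split: if_splits option.splits)

definition contraction_semigroup :: "(real \<Rightarrow> 'a::complex_inner \<Rightarrow> 'a) \<Rightarrow> bool" where
  "contraction_semigroup U \<longleftrightarrow>
     (\<forall>t\<ge>0. (\<lambda>x. Some (U t x)) \<in> bounded_ops \<and> (\<forall>x. norm (U t x) \<le> norm x)) \<and>
     U 0 = id \<and>
     (\<forall>s\<ge>0. \<forall>t\<ge>0. U (s + t) = U s \<circ> U t) \<and>
     (\<forall>x. continuous_on {0..} (\<lambda>t. U t x))"

definition generator :: "(real \<Rightarrow> 'a::complex_inner \<Rightarrow> 'a) \<Rightarrow> ('a \<rightharpoonup> 'a)" where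
  "generator U = op_of_graph {(x, y). ((\<lambda>t. (U t x - x) /\<^sub>R t) \<longlongrightarrow> y) (at_right 0)}"

(* The semigroup U is the one written t \<mapsto> exp (t G). *)
definition generates_contraction_semigroup :: "('a::complex_inner \<rightharpoonup> 'a) \<Rightarrow> bool" where
  "generates_contraction_semigroup G \<longleftrightarrow> (\<exists>U. contraction_semigroup U \<and> generator U = G)"

end

theory Submission
  imports Defs
begin

text \<open>
  Put \<open>T = A\<^sup>* A\<close>. Projecting \<open>(h, 0)\<close> orthogonally onto the graph of \<open>A\<close> shows that \<open>1 + T\<close> is onto, and
  coercivity makes \<open>T\<close> itself onto with a bounded positive inverse \<open>B\<close>. If \<open>C\<close> is the positive square
  root of \<open>B\<close>, then \<open>|A| = C\<^sup>-\<^sup>1\<close>, so every statement about \<open>|A|\<close> becomes one about \<open>C\<close>. In particular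
  \<open>K = R C\<close> is everywhere defined, hence bounded by the closed graph theorem,
  \<open>Q (f, g) = (h, k)\<close> means \<open>f = C k\<close> and \<open>g = C (h + i K k)\<close>, and the resolvent of \<open>Q\<close> solves
  \<open>f = C k + z M(z)\<^sup>-\<^sup>1 w\<close>, \<open>g = |A| M(z)\<^sup>-\<^sup>1 w\<close> with \<open>w = h + (i R + z) C k\<close>.

  For accretive \<open>R\<close> the operator \<open>G = - i Q\<close> is dissipative. Since \<open>0\<close> lies in the resolvent set, the
  contraction principle yields surjectivity of \<open>l - G\<close> first for small and then for all \<open>l > 0\<close>. The
  semigroup is the limit of the solutions of \<open>u' = Y\<^sub>n u\<close> for the Yosida approximations \<open>Y\<^sub>n\<close> of \<open>G\<close>.
\<close>


text \<open>The recurring form \<open>T x = Some y \<longleftrightarrow> x = c y\<close>, with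
  \<open>c\<close> a total map, fixes domain, range and values of an unbounded operator at once;
  closedness, inverses and resolvents are read off from \<open>c\<close>. Taking the square root of
  the bounded inverse avoids a spectral theorem for unbounded operators. As \<open>op_abs\<close> is
  a definite description, uniqueness has to be proved among all selfadjoint nonnegative roots of A^*
  A: the inverse of any such root is a bounded positive root of the inverse of A^* A, so the
  question becomes one about bounded operators. The hypothesis on domains speaks of A, whereas
  \<open>R\<close> is applied on dom |A|. The inclusion of dom |A| in dom A closes this gap and is
  what makes R C everywhere defined. Another gap concerns the resolvent of Q: M(z)^-1 is assumed
  bounded, but |A| M(z)^-1 also occurs; its boundedness comes from the closed graph theorem, Q - z
  being closed.\<close>

instance chilbert_space \<subseteq> banach ..

section \<open>Complex inner products and scalars\<close>

lemma cinner_add_left: "cinner (x + y) z = cinner x z + cinner y z"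
  by (metis cinner_add_right cinner_commute complex_cnj_add)

lemma cinner_scaleC_left: "cinner (c *\<^sub>C x) y = cnj c * cinner x y"
  by (metis cinner_scaleC_right cinner_commute complex_cnj_mult)

lemma cinner_zero_right [simp]: "cinner x 0 = 0"
  using cinner_add_right[of x 0 0] by simp

lemma cinner_zero_left [simp]: "cinner 0 x = 0"
  using cinner_add_left[of 0 0 x] by simp

lemma cinner_minus_right [simp]: "cinner x (- y) = - cinner x y"
  using cinner_add_right[of x y "- y"] by (simp add: eq_neg_iff_add_eq_0 add.commute)

lemma cinner_minus_left [simp]: "cinner (- x) y = - cinner x y"
  using cinner_add_left[of x "- x" y] by (simp add: eq_neg_iff_add_eq_0 add.commute)

lemma cinner_diff_right: "cinner x (y - z) = cinner x y - cinner x z"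
  using cinner_add_right[of x y "- z"] by simp

lemma cinner_diff_left: "cinner (x - y) z = cinner x z - cinner y z"
  using cinner_add_left[of x "- y" z] by simp

text \<open>A complex identity thus follows from its real part once that is known for all multiples
  by \<i>; this lets the geometry below be done over the reals.\<close>

lemma Im_cinner: "Im (cinner x y) = - inner x (\<i> *\<^sub>C y)"
  by (simp add: inner_Re_cinner cinner_scaleC_right)

lemma cinner_self: "cinner x x = complex_of_real ((norm x)\<^sup>2)"
proof -
  have "Im (cinner x x) = 0"
    using cinner_commute[of x x] by (simp add: complex_eq_iff)
  then show ?thesis
    by (simp add: complex_eq_iff power2_norm_eq_inner inner_Re_cinner)
qed

lemma inner_eqI: "(\<And>y. inner x y = inner x' y) \<Longrightarrow> x = x'"
  by (metis vector_eq_rdot)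

lemma norm_scaleC: "norm (c *\<^sub>C x) = cmod c * norm x"
proof -
  have "cinner (c *\<^sub>C x) (c *\<^sub>C x) = complex_of_real ((cmod c * norm x)\<^sup>2)"
    unfolding cinner_scaleC_left cinner_scaleC_right unfolding cinner_self
    by (simp add: power_mult_distrib complex_norm_square[of c] mult_ac del: of_real_power)
  then have "(norm (c *\<^sub>C x))\<^sup>2 = (cmod c * norm x)\<^sup>2"
    unfolding cinner_self of_real_eq_iff .
  then show ?thesis by simp
qed

lemma scaleC_zero_left [simp]: "0 *\<^sub>C x = 0"
  using norm_scaleC[of 0 x] by simp

lemma scaleC_zero_right [simp]: "c *\<^sub>C 0 = 0"
  using norm_scaleC[of c 0] by simp

lemma scaleC_one [simp]: "1 *\<^sub>C x = x"
  using scaleR_scaleC[of 1 x] by simp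

lemma scaleC_minus_left [simp]: "(- c) *\<^sub>C x = - (c *\<^sub>C x)"
  using scaleC_add_left[of c "- c" x] by (simp add: eq_neg_iff_add_eq_0 add.commute)

lemma scaleC_minus_right [simp]: "c *\<^sub>C (- x) = - (c *\<^sub>C x)"
  using scaleC_add_right[of c x "- x"] by (simp add: eq_neg_iff_add_eq_0 add.commute)

lemma scaleC_diff_right: "c *\<^sub>C (x - y) = c *\<^sub>C x - c *\<^sub>C y"
  using scaleC_add_right[of c x "- y"] by simp

lemma bounded_linear_scaleC: "bounded_linear (scaleC c)"
proof (rule bounded_linear_intro)
  show "c *\<^sub>C (r *\<^sub>R x) = r *\<^sub>R c *\<^sub>C x" for r x
    by (simp add: scaleR_scaleC scaleC_scaleC mult.commute)
  show "norm (c *\<^sub>C x) \<le> norm x * cmod c" for x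
    by (simp add: norm_scaleC)
qed (simp add: scaleC_add_right)

lemma tendsto_scaleC: "(f \<longlongrightarrow> l) F \<Longrightarrow> ((\<lambda>x. c *\<^sub>C f x) \<longlongrightarrow> c *\<^sub>C l) F"
  by (rule bounded_linear.tendsto[OF bounded_linear_scaleC])

lemma subspace_closure:
  fixes V :: "'a::real_normed_vector set"
  assumes "subspace V"
  shows "subspace (closure V)"
proof (rule subspaceI)
  show "0 \<in> closure V" using subspace_0[OF assms] closure_subset by blast
  show "x + y \<in> closure V" if xy: "x \<in> closure V" "y \<in> closure V" for x y
  proof -
    obtain f g where "\<And>n. f n \<in> V" "f \<longlonglongrightarrow> x" "\<And>n. g n \<in> V" "g \<longlonglongrightarrow> y"
      using xy unfolding closure_sequential by blast
    then show ?thesis unfolding closure_sequential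
      by (intro exI[of _ "\<lambda>n. f n + g n"]) (auto intro: tendsto_add subspace_add[OF assms])
  qed
  show "c *\<^sub>R x \<in> closure V" if x: "x \<in> closure V" for c x
  proof -
    obtain f where "\<And>n. f n \<in> V" "f \<longlonglongrightarrow> x"
      using x unfolding closure_sequential by blast
    then show ?thesis unfolding closure_sequential
      by (intro exI[of _ "\<lambda>n. c *\<^sub>R f n"]) (auto intro: tendsto_scaleR subspace_scale[OF assms])
  qed
qed

section \<open>Orthogonal projection\<close>

text \<open>A sequence in \<open>V\<close> minimizing the distance to \<open>x\<close> is Cauchy by
  the parallelogram law, since midpoints stay in \<open>V\<close>; moving the limit in direction
  \<open>v\<close> cannot lower the distance, which forces orthogonality.\<close>

lemma orthogonal_projection_exists:
  fixes V :: "'a::{real_inner,complete_space} set"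
  assumes "subspace V" "closed V"
  obtains p where "p \<in> V" "\<And>v. v \<in> V \<Longrightarrow> inner (x - p) v = 0"
proof -
  define d where "d = Inf ((\<lambda>v. (norm (x - v))\<^sup>2) ` V)"
  have V0: "0 \<in> V" using assms(1) by (rule subspace_0)
  have bdd: "bdd_below ((\<lambda>v. (norm (x - v))\<^sup>2) ` V)" by (rule bdd_belowI[of _ 0]) auto
  have dle: "d \<le> (norm (x - v))\<^sup>2" if "v \<in> V" for v
    unfolding d_def using bdd that by (auto intro: cInf_lower)
  have "\<exists>v\<in>V. (norm (x - v))\<^sup>2 < d + inverse (real (Suc n))" for n
  proof -
    have "Inf ((\<lambda>v. (norm (x - v))\<^sup>2) ` V) < d + inverse (real (Suc n))"
      unfolding d_def by simp
    then show ?thesis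
      by (subst (asm) cInf_less_iff) (use V0 bdd in auto)
  qed
  then obtain s where sV: "\<And>n. s n \<in> V"
    and sd: "\<And>n. (norm (x - s n))\<^sup>2 < d + inverse (real (Suc n))" by metis
  have par: "(norm (s m - s n))\<^sup>2 \<le> 2 * (inverse (real (Suc m)) + inverse (real (Suc n)))" for m n
  proof -
    have "(1/2) *\<^sub>R (s m + s n) \<in> V"
      using assms(1) sV by (auto intro: subspace_scale subspace_add)
    from dle[OF this] have "4 * d \<le> (norm (2 *\<^sub>R (x - (1/2) *\<^sub>R (s m + s n))))\<^sup>2"
      by (simp add: power_mult_distrib del: scaleR_left.diff)
    also have "2 *\<^sub>R (x - (1/2) *\<^sub>R (s m + s n)) = (x - s m) + (x - s n)"
      by (simp add: scaleR_2 algebra_simps)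
    finally have 1: "4 * d \<le> (norm ((x - s m) + (x - s n)))\<^sup>2" .
    have "(norm (s m - s n))\<^sup>2 = 2 * (norm (x - s m))\<^sup>2 + 2 * (norm (x - s n))\<^sup>2
        - (norm ((x - s m) + (x - s n)))\<^sup>2"
      by (simp add: power2_norm_eq_inner inner_add_left inner_add_right inner_diff_left
          inner_diff_right inner_commute algebra_simps)
    then show ?thesis using 1 sd[of m] sd[of n] by simp
  qed
  have "Cauchy s"
  proof (rule metric_CauchyI)
    fix e :: real assume "e > 0"
    then obtain N where N: "inverse (real (Suc N)) < e\<^sup>2 / 4"
      using reals_Archimedean[of "e\<^sup>2 / 4"] by auto
    have "dist (s m) (s n) < e" if "m \<ge> N" "n \<ge> N" for m n
    proof -
      have "inverse (real (Suc m)) \<le> inverse (real (Suc N))"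
        "inverse (real (Suc n)) \<le> inverse (real (Suc N))"
        using that by auto
      then have "2 * (inverse (real (Suc m)) + inverse (real (Suc n)))
          \<le> 2 * (inverse (real (Suc N)) + inverse (real (Suc N)))"
        by (intro mult_left_mono add_mono) auto
      also have "\<dots> < e\<^sup>2" using N by simp
      finally have "(norm (s m - s n))\<^sup>2 < e\<^sup>2" using par[of m n] by linarith
      then show ?thesis using \<open>e > 0\<close> by (simp add: dist_norm power2_less_imp_less[of _ e])
    qed
    then show "\<exists>M. \<forall>m\<ge>M. \<forall>n\<ge>M. dist (s m) (s n) < e" by blast
  qed
  then obtain p where p: "s \<longlonglongrightarrow> p" using Cauchy_convergent convergent_def by blast
  have pV: "p \<in> V" using closed_sequentially[OF assms(2)] sV p by blast
  have "(\<lambda>n. d + inverse (real (Suc n))) \<longlonglongrightarrow> d + 0"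
    by (intro tendsto_add tendsto_const LIMSEQ_inverse_real_of_nat)
  moreover have "(\<lambda>n. (norm (x - s n))\<^sup>2) \<longlonglongrightarrow> (norm (x - p))\<^sup>2"
    by (intro tendsto_intros p)
  ultimately have pd: "(norm (x - p))\<^sup>2 \<le> d"
    using sd by (intro LIMSEQ_le[of _ _ "\<lambda>n. d + inverse (real (Suc n))" d]) (auto intro: less_imp_le)
  have "inner (x - p) v = 0" if "v \<in> V" for v
  proof (rule ccontr)
    assume nz: "inner (x - p) v \<noteq> 0"
    then have v0: "inner v v > 0" by auto
    \<comment> \<open>The minimizer of the distance from \<open>x\<close> along the line p + t
      v.\<close>
    define t where "t = inner (x - p) v / inner v v"
    have "p + t *\<^sub>R v \<in> V" using assms(1) pV that by (intro subspace_add subspace_scale)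
    from order_trans[OF pd dle[OF this]] have "(norm (x - p))\<^sup>2 \<le> (norm (x - (p + t *\<^sub>R v)))\<^sup>2" .
    also have "\<dots> = (norm ((x - p) - t *\<^sub>R v))\<^sup>2" by (simp add: algebra_simps)
    also have "\<dots> = (norm (x - p))\<^sup>2 - 2 * t * inner (x - p) v + t * (t * inner v v)"
      unfolding power2_norm_eq_inner by (simp add: inner_diff_left inner_diff_right inner_commute algebra_simps)
    also have "t * inner v v = inner (x - p) v" using v0 by (simp add: t_def)
    finally have "t * inner (x - p) v \<le> 0" by simp
    moreover have "t * inner (x - p) v > 0"
      using nz v0 by (simp add: t_def zero_less_divide_iff zero_less_mult_iff)
        (metis linorder_neqE_linordered_idom)
    ultimately show False by simp
  qed
  with pV that show thesis by blast
qed

text \<open>The residual of the projection onto the closure is orthogonal to \<open>V\<close>, so it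
  vanishes.\<close>

lemma dense_if_orthogonal_trivial:
  fixes V :: "'a::{real_inner,complete_space} set"
  assumes "subspace V" and triv: "\<And>x. (\<And>v. v \<in> V \<Longrightarrow> inner x v = 0) \<Longrightarrow> x = 0"
  shows "closure V = UNIV"
proof -
  have "x \<in> closure V" for x
  proof -
    obtain p where p: "p \<in> closure V" "\<And>v. v \<in> closure V \<Longrightarrow> inner (x - p) v = 0"
      using orthogonal_projection_exists[of "closure V" x] closed_closure[of V]
        subspace_closure[OF assms(1)] by metis
    then have "x - p = 0" using triv closure_subset by blast
    with p(1) show ?thesis by simp
  qed
  then show ?thesis by auto
qed

section \<open>Square roots of bounded positive operators\<close>

text \<open>Stated for real inner products: the square root construction is real, and complex
  homogeneity of the root is recovered afterwards from its commutation with multiplication by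
  scalars.\<close>

definition positive_symmetric :: "('a::real_inner \<Rightarrow> 'a) \<Rightarrow> bool" where
  "positive_symmetric B \<longleftrightarrow> bounded_linear B \<and> (\<forall>x y. inner (B x) y = inner x (B y)) \<and>
     (\<forall>x. 0 \<le> inner x (B x))"

text \<open>Expand the nonnegative form of \<open>B\<close> at x - t B x with t = 1/k: the quadratic
  term is at most t times the squared norm of B x, which leaves half of the mixed term.\<close>

lemma positive_symmetric_norm_le:
  assumes "positive_symmetric B" and k: "\<And>x. norm (B x) \<le> k * norm x" and "k > 0"
  shows "(norm (B x))\<^sup>2 \<le> k * inner x (B x)"
proof -
  interpret B: bounded_linear B using assms(1) by (simp add: positive_symmetric_def)
  have sym: "inner (B x) y = inner x (B y)" and pos: "0 \<le> inner x (B x)" for x y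
    using assms(1) by (auto simp: positive_symmetric_def)
  define t where "t = 1 / k"
  have t: "t * k = 1" "t > 0" using \<open>k > 0\<close> by (auto simp: t_def)
  have "0 \<le> inner (x - t *\<^sub>R B x) (B (x - t *\<^sub>R B x))" by (rule pos)
  also have "\<dots> = inner x (B x) - 2 * t * inner (B x) (B x) + t * (t * inner (B x) (B (B x)))"
    by (simp add: B.diff B.scaleR inner_diff_left inner_diff_right sym algebra_simps)
  finally have 1: "0 \<le> inner x (B x) - 2 * t * inner (B x) (B x) + t * (t * inner (B x) (B (B x)))" .
  have "inner (B x) (B (B x)) \<le> norm (B x) * norm (B (B x))" by (rule norm_cauchy_schwarz)
  also have "\<dots> \<le> norm (B x) * (k * norm (B x))" by (intro mult_left_mono k) auto
  also have "\<dots> = k * inner (B x) (B x)" by (simp add: power2_norm_eq_inner[symmetric] power2_eq_square)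
  finally have "t * inner (B x) (B (B x)) \<le> t * (k * inner (B x) (B x))"
    using t by (intro mult_left_mono) auto
  also have "\<dots> = inner (B x) (B x)" using t by (simp flip: mult.assoc)
  finally have "t * (t * inner (B x) (B (B x))) \<le> t * inner (B x) (B x)"
    using t by (intro mult_left_mono) auto
  with 1 have "t * inner (B x) (B x) \<le> inner x (B x)" by simp
  then have "k * (t * inner (B x) (B x)) \<le> k * inner x (B x)"
    using \<open>k > 0\<close> by (intro mult_left_mono) auto
  then show ?thesis using t by (simp add: power2_norm_eq_inner mult.commute flip: mult.assoc)
qed

lemma positive_symmetric_eq_0:
  assumes "positive_symmetric B" "inner x (B x) = 0"
  shows "B x = 0"
proof -
  obtain k where "k > 0" "\<And>x. norm (B x) \<le> norm x * k"
    using assms(1) bounded_linear.pos_bounded unfolding positive_symmetric_def by blast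
  then show ?thesis
    using positive_symmetric_norm_le[OF assms(1), of k x] assms(2) by (simp add: mult.commute)
qed

text \<open>The iterates converge to \<open>1 - sqrt (1 - X)\<close>. The scalar case \<open>X = 1\<close> majorizes their increments in
  norm.\<close>

primrec sqrt_iter :: "'a::real_normed_vector \<Rightarrow>\<^sub>L 'a \<Rightarrow> nat \<Rightarrow> 'a \<Rightarrow>\<^sub>L 'a" where
  "sqrt_iter X 0 = 0"
| "sqrt_iter X (Suc n) = (1/2) *\<^sub>R (X + (sqrt_iter X n o\<^sub>L sqrt_iter X n))"

primrec scalar_iter :: "nat \<Rightarrow> real" where
  "scalar_iter 0 = 0"
| "scalar_iter (Suc n) = (1 + (scalar_iter n)\<^sup>2) / 2"

lemma scalar_iter_bounds: "0 \<le> scalar_iter n \<and> scalar_iter n \<le> 1"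
  by (induction n) (auto simp: power_le_one)

lemma incseq_scalar_iter: "incseq scalar_iter"
proof (rule incseq_SucI)
  fix n
  have "0 \<le> (1 - scalar_iter n)\<^sup>2" by simp
  then show "scalar_iter n \<le> scalar_iter (Suc n)" by (simp add: power2_diff)
qed

lemma norm_sqrt_iter_le: "norm X \<le> 1 \<Longrightarrow> norm (sqrt_iter X n) \<le> scalar_iter n"
proof (induction n)
  case (Suc n)
  have "norm (X + (sqrt_iter X n o\<^sub>L sqrt_iter X n)) \<le> norm X + norm (sqrt_iter X n o\<^sub>L sqrt_iter X n)"
    by (rule norm_triangle_ineq)
  also have "\<dots> \<le> 1 + norm (sqrt_iter X n) * norm (sqrt_iter X n)"
    by (rule add_mono[OF Suc.prems norm_blinfun_compose])
  also have "norm (sqrt_iter X n) * norm (sqrt_iter X n) \<le> scalar_iter n * scalar_iter n"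
    using Suc.IH[OF Suc.prems] scalar_iter_bounds[of n] by (intro mult_mono) auto
  finally show ?case by (simp add: power2_eq_square)
qed simp

text \<open>A difference of squares Y'^2 - Y^2 is Y' (Y' - Y) + (Y' - Y) Y, whether or not the
  factors commute. The same factorization is exact for the scalars, so the majorization passes from
  one step to the next.\<close>

lemma norm_sqrt_iter_step_le:
  assumes "norm X \<le> 1"
  shows "norm (sqrt_iter X (Suc n) - sqrt_iter X n) \<le> scalar_iter (Suc n) - scalar_iter n"
proof (induction n)
  case 0 then show ?case using assms by simp
next
  case (Suc n)
  let ?Y = "sqrt_iter X" and ?y = "scalar_iter"
  have mono: "?y n \<le> ?y (Suc n)" using incseq_SucD[OF incseq_scalar_iter] .
  have "?Y (Suc (Suc n)) - ?Y (Suc n) =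
      (1/2) *\<^sub>R ((?Y (Suc n) o\<^sub>L ?Y (Suc n)) - (?Y n o\<^sub>L ?Y n))"
    unfolding sqrt_iter.simps(2)[of X "Suc n"]
    by (subst (3) sqrt_iter.simps(2)) (simp add: scaleR_diff_right scaleR_add_right del: sqrt_iter.simps)
  also have "(?Y (Suc n) o\<^sub>L ?Y (Suc n)) - (?Y n o\<^sub>L ?Y n)
      = (?Y (Suc n) o\<^sub>L (?Y (Suc n) - ?Y n)) + ((?Y (Suc n) - ?Y n) o\<^sub>L ?Y n)"
    by (rule blinfun_eqI)
      (simp only: blinfun.diff_left blinfun.add_left blinfun_apply_blinfun_compose blinfun.diff_right, simp)
  finally have "norm (?Y (Suc (Suc n)) - ?Y (Suc n)) \<le>
     (1/2) * (norm (?Y (Suc n) o\<^sub>L (?Y (Suc n) - ?Y n)) + norm ((?Y (Suc n) - ?Y n) o\<^sub>L ?Y n))"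
    by (simp only: norm_scaleR) (simp add: norm_triangle_ineq)
  also have "\<dots> \<le> (1/2) * (?y (Suc n) * (?y (Suc n) - ?y n) + (?y (Suc n) - ?y n) * ?y n)"
    using Suc.IH norm_sqrt_iter_le[OF assms, of n] norm_sqrt_iter_le[OF assms, of "Suc n"]
      scalar_iter_bounds[of n] scalar_iter_bounds[of "Suc n"] mono
    by (intro mult_left_mono add_mono order_trans[OF norm_blinfun_compose] mult_mono)
       (simp_all del: sqrt_iter.simps scalar_iter.simps)
  also have "\<dots> = ?y (Suc (Suc n)) - ?y (Suc n)"
    by (simp only: scalar_iter.simps(2)[of "Suc n"] scalar_iter.simps(2)[of n])
      (simp add: power2_eq_square field_simps)
  finally show ?case .
qed

text \<open>The increments telescope below those of \<open>scalar_iter\<close>, which is increasing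
  and bounded by 1.\<close>

lemma convergent_sqrt_iter:
  fixes X :: "'a::banach \<Rightarrow>\<^sub>L 'a"
  assumes "norm X \<le> 1"
  shows "convergent (sqrt_iter X)"
proof -
  have le: "norm (sqrt_iter X m - sqrt_iter X n) \<le> scalar_iter m - scalar_iter n" if "n \<le> m" for m n
    using that
  proof (induction m rule: dec_induct)
    case (step m)
    have "norm (sqrt_iter X (Suc m) - sqrt_iter X n) \<le>
      norm (sqrt_iter X (Suc m) - sqrt_iter X m) + norm (sqrt_iter X m - sqrt_iter X n)"
      by (rule norm_diff_triangle_le[OF order_refl order_refl])
    also have "\<dots> \<le> scalar_iter (Suc m) - scalar_iter n"
      using norm_sqrt_iter_step_le[OF assms, of m] step.IH by linarith
    finally show ?case .
  qed simp
  have "convergent scalar_iter"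
    using incseq_scalar_iter scalar_iter_bounds incseq_convergent[of scalar_iter 1]
    by (metis convergent_def)
  then have C: "Cauchy scalar_iter" by (rule convergent_Cauchy)
  have "Cauchy (sqrt_iter X)"
  proof (rule metric_CauchyI)
    fix e :: real assume "e > 0"
    with C obtain N where N: "\<And>m n. m \<ge> N \<Longrightarrow> n \<ge> N \<Longrightarrow> dist (scalar_iter m) (scalar_iter n) < e"
      by (metis metric_CauchyD)
    have "dist (sqrt_iter X m) (sqrt_iter X n) < e" if "m \<ge> N" "n \<ge> N" for m n
      using le[of m n] le[of n m] N[OF that] linear[of m n]
      by (auto simp: dist_norm norm_minus_commute)
    then show "\<exists>M. \<forall>m\<ge>M. \<forall>n\<ge>M. dist (sqrt_iter X m) (sqrt_iter X n) < e" by blast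
  qed
  then show ?thesis by (rule Cauchy_convergent)
qed

text \<open>With X = 1 - B/k the limit Y of the iterates satisfies 2 Y = X + Y^2, that is (1 - Y)^2
  = B/k, so C = sqrt k (1 - Y) is a root. The iterates are polynomials in X, hence whatever commutes
  with \<open>B\<close> commutes with \<open>C\<close>; this last clause gives both uniqueness and
  complex homogeneity later.\<close>

lemma positive_sqrt_exists:
  fixes B :: "'a::{real_inner,banach} \<Rightarrow> 'a"
  assumes "positive_symmetric B"
  obtains C where "positive_symmetric C" "\<And>x. C (C x) = B x"
    "\<And>L x. bounded_linear L \<Longrightarrow> (\<And>x. L (B x) = B (L x)) \<Longrightarrow> L (C x) = C (L x)"
proof -
  interpret B: bounded_linear B using assms(1) by (simp add: positive_symmetric_def)
  have sym: "inner (B x) y = inner x (B y)" and pos: "0 \<le> inner x (B x)" for x y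
    using assms(1) by (auto simp: positive_symmetric_def)
  obtain k where k: "k > 0" "\<And>x. norm (B x) \<le> k * norm x"
    using B.pos_bounded by (metis mult.commute)
  define Xf where "Xf = (\<lambda>x. x - (1/k) *\<^sub>R B x)"
  have "bounded_linear Xf"
    unfolding Xf_def by (intro bounded_linear_sub bounded_linear_ident bounded_linear_scaleR_right
        bounded_linear_compose[OF bounded_linear_scaleR_right B.bounded_linear_axioms])
  then obtain X where X: "blinfun_apply X = Xf" by (metis bounded_linear_Blinfun_apply)
  \<comment> \<open>Positivity of \<open>B\<close> enters through
    \<open>positive_symmetric_norm_le\<close>: the quadratic term of the expansion is absorbed by
    half of the linear one.\<close>
  have "norm (Xf x) \<le> norm x" for x
  proof -
    have "(norm (Xf x))\<^sup>2 = (norm x)\<^sup>2 - (2/k) * inner x (B x) + (1/k) * ((1/k) * (norm (B x))\<^sup>2)"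
      unfolding power2_norm_eq_inner Xf_def
      by (simp add: inner_diff_left inner_diff_right inner_commute sym algebra_simps)
    also have "\<dots> \<le> (norm x)\<^sup>2 - (2/k) * inner x (B x) + (1/k) * ((1/k) * (k * inner x (B x)))"
      using positive_symmetric_norm_le[OF assms k(2,1), of x] k(1)
      by (intro add_left_mono mult_left_mono) auto
    also have "\<dots> = (norm x)\<^sup>2 - (1/k) * inner x (B x)" using k(1) by (simp add: field_simps)
    also have "\<dots> \<le> (norm x)\<^sup>2" using pos k(1) by simp
    finally show ?thesis by (rule power2_le_imp_le) simp
  qed
  then have X1: "norm X \<le> 1" by (intro norm_blinfun_bound) (auto simp: X)
  obtain Y where Y: "sqrt_iter X \<longlonglongrightarrow> Y" using convergent_sqrt_iter[OF X1] convergent_def by blast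
  have Yx: "(\<lambda>n. sqrt_iter X n x) \<longlonglongrightarrow> Y x" for x
    by (intro blinfun.tendsto Y tendsto_const)
  have Y1: "norm Y \<le> 1"
    by (rule LIMSEQ_le_const2[OF tendsto_norm[OF Y]])
      (use norm_sqrt_iter_le[OF X1] scalar_iter_bounds order_trans in blast)
  have "(\<lambda>n. sqrt_iter X (Suc n)) \<longlonglongrightarrow> (1/2) *\<^sub>R (X + (Y o\<^sub>L Y))"
    unfolding sqrt_iter.simps by (intro tendsto_intros Y bounded_bilinear.tendsto[OF bounded_bilinear_blinfun_compose])
  then have "Y = (1/2) *\<^sub>R (X + (Y o\<^sub>L Y))" using Y LIMSEQ_Suc LIMSEQ_unique by blast
  then have "Y x = (1/2) *\<^sub>R (X x + Y (Y x))" for x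
    by (metis blinfun.scaleR_left blinfun.add_left blinfun_apply_blinfun_compose)
  from arg_cong[OF this, of "\<lambda>v. 2 *\<^sub>R v"]
  have Yfix: "2 *\<^sub>R Y x = X x + Y (Y x)" for x by simp
  have symY: "inner (Y x) y = inner x (Y y)" for x y
  proof -
    have "inner (sqrt_iter X n x) y = inner x (sqrt_iter X n y)" for n x y
    proof (induction n arbitrary: x y)
      case (Suc n)
      show ?case
        by (simp add: blinfun.add_left blinfun.scaleR_left Suc.IH inner_add_left inner_add_right
            X Xf_def inner_diff_left inner_diff_right sym)
    qed simp
    then show ?thesis
      using tendsto_inner[OF Yx tendsto_const, of x y] tendsto_inner[OF tendsto_const Yx, of x y]
        LIMSEQ_unique by simp
  qed
  define r where "r = sqrt k"
  have r: "r > 0" "r * r = k" using k(1) by (auto simp: r_def)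
  define C where "C = (\<lambda>x. r *\<^sub>R (x - Y x))"
  have "bounded_linear C"
    unfolding C_def by (intro bounded_linear_sub bounded_linear_ident blinfun.bounded_linear_right
        bounded_linear_compose[OF bounded_linear_scaleR_right])
  moreover have "0 \<le> inner x (C x)" for x
  proof -
    have "inner x (Y x) \<le> norm x * norm (Y x)" by (rule norm_cauchy_schwarz)
    also have "\<dots> \<le> norm x * (1 * norm x)"
      by (intro mult_left_mono order_trans[OF norm_blinfun] mult_right_mono Y1) auto
    finally have "inner x (Y x) \<le> inner x x" by (simp add: power2_norm_eq_inner[symmetric] power2_eq_square)
    then show ?thesis using r by (simp add: C_def inner_diff_right)
  qed
  ultimately have 1: "positive_symmetric C"
    by (auto simp: positive_symmetric_def C_def inner_diff_left inner_diff_right symY)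
  have 2: "C (C x) = B x" for x
  proof -
    have "C (C x) = k *\<^sub>R (x - 2 *\<^sub>R Y x + Y (Y x))"
      by (simp add: C_def blinfun.diff_right blinfun.scaleR_right flip: r(2))
        (simp add: algebra_simps scaleR_2)
    also have "\<dots> = k *\<^sub>R (x - X x)" using Yfix[of x] by simp
    also have "\<dots> = B x" using k(1) by (simp add: X Xf_def)
    finally show ?thesis .
  qed
  have 3: "L (C x) = C (L x)" if "bounded_linear L" and LB: "\<And>x. L (B x) = B (L x)" for L x
  proof -
    interpret L: bounded_linear L by fact
    have "L (sqrt_iter X n x) = sqrt_iter X n (L x)" for n x
      by (induction n arbitrary: x)
        (simp_all add: L.zero blinfun.add_left blinfun.scaleR_left L.scaleR L.add L.diff X Xf_def LB)
    then have "L (Y x) = Y (L x)"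
      using L.tendsto[OF Yx[of x]] Yx[of "L x"] LIMSEQ_unique by simp
    then show ?thesis by (simp add: C_def L.scaleR L.diff)
  qed
  from that[OF 1 2 3] show thesis by blast
qed

text \<open>For commuting roots E, F and y = E x - F x one has (E + F) y = 0, so both forms vanish
  at y, E y = F y = 0, and therefore y = 0. Commutation of \<open>C\<close> with \<open>D\<close> is
  not known beforehand; but each commutes with the common square, hence with the root constructed
  from it, through which the two are compared.\<close>

lemma positive_sqrt_unique:
  fixes C D :: "'a::{real_inner,banach} \<Rightarrow> 'a"
  assumes C: "positive_symmetric C" and D: "positive_symmetric D" and CD: "\<And>x. C (C x) = D (D x)"
  shows "C = D"
proof -
  have unique: "E = F" if E: "positive_symmetric E" and F: "positive_symmetric F"
    and sq: "\<And>x. E (E x) = F (F x)" and comm: "\<And>x. E (F x) = F (E x)" for E F :: "'a \<Rightarrow> 'a"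
  proof
    fix x
    interpret E: bounded_linear E using E by (simp add: positive_symmetric_def)
    interpret F: bounded_linear F using F by (simp add: positive_symmetric_def)
    define y where "y = E x - F x"
    have "E y + F y = 0" by (simp add: y_def E.diff F.diff sq comm)
    then have "inner y (E y) + inner y (F y) = 0" by (metis inner_add_right inner_zero_right)
    moreover have "0 \<le> inner y (E y)" "0 \<le> inner y (F y)"
      using E F by (auto simp: positive_symmetric_def)
    ultimately have "E y = 0" "F y = 0"
      using positive_symmetric_eq_0[OF E] positive_symmetric_eq_0[OF F]
      by (auto intro: antisym simp: add_nonneg_eq_0_iff)
    moreover have "inner y y = inner x (E y) - inner x (F y)"
      using E F by (auto simp: y_def positive_symmetric_def inner_diff_left)
    ultimately show "E x = F x" by (simp add: y_def)
  qed
  have B: "positive_symmetric (\<lambda>x. C (C x))"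
  proof -
    interpret C: bounded_linear C using C by (simp add: positive_symmetric_def)
    have sym: "inner (C x) y = inner x (C y)" for x y using C by (simp add: positive_symmetric_def)
    have "0 \<le> inner x (C (C x))" for x using inner_ge_zero[of "C x"] by (simp add: sym)
    then show ?thesis
      using bounded_linear_compose[OF C.bounded_linear_axioms C.bounded_linear_axioms]
      by (simp add: positive_symmetric_def sym)
  qed
  obtain E where E: "positive_symmetric E" "\<And>x. E (E x) = C (C x)"
    "\<And>L x. bounded_linear L \<Longrightarrow> (\<And>x. L (C (C x)) = C (C (L x))) \<Longrightarrow> L (E x) = E (L x)"
    using positive_sqrt_exists[OF B] by blast
  have "C = E"
  proof (rule unique[OF C E(1)])
    show "C (E x) = E (C x)" for x
      by (rule E(3)) (use C in \<open>auto simp: positive_symmetric_def\<close>)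
  qed (simp add: E)
  moreover have "D = E"
  proof (rule unique[OF D E(1)])
    show "D (E x) = E (D x)" for x
      by (rule E(3)) (use D in \<open>auto simp: positive_symmetric_def CD\<close>)
  qed (simp add: E CD)
  ultimately show ?thesis by simp
qed

section \<open>The closed graph theorem\<close>

text \<open>By Baire, some set of points with norm (T x) at most n is dense in a ball. Hence every y
  is approximated arbitrarily well by some x with norm (T x) at most K norm y. Corrections with
  geometrically decreasing errors sum to y, and closedness of the graph identifies T y with the sum
  of the images.\<close>

lemma closed_graph_theorem:
  fixes T :: "'a::banach \<Rightarrow> 'b::banach"
  assumes lin: "linear T"
    and cl: "\<And>f x y. f \<longlonglongrightarrow> x \<Longrightarrow> (\<lambda>n. T (f n)) \<longlonglongrightarrow> y \<Longrightarrow> T x = y"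
  shows "bounded_linear T"
proof -
  interpret T: linear T by fact
  define E where "E n = closure {x. norm (T x) \<le> real n}" for n :: nat
  have "\<exists>n. interior (E n) \<noteq> {}"
  proof (rule ccontr)
    assume "\<not> ?thesis"
    then have "(euclidean :: 'a topology) interior_of (\<Union> (range E)) = {}"
      by (intro Baire_category_alt) (auto simp: completely_metrizable_space_euclidean E_def)
    moreover have "x \<in> \<Union> (range E)" for x
    proof -
      obtain n :: nat where "norm (T x) \<le> real n" using real_arch_simple[of "norm (T x)"] ..
      then have "x \<in> E n" unfolding E_def by (intro subsetD[OF closure_subset]) simp
      then show ?thesis by blast
    qed
    then have "\<Union> (range E) = UNIV" by auto
    ultimately show False by simp
  qed
  then obtain n x0 where "x0 \<in> interior (E n)" by blast
  then obtain r where r: "r > 0" "ball x0 r \<subseteq> E n"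
    using mem_interior by blast
  have near: "\<exists>x. norm (y - x) < e \<and> norm (T x) \<le> real n" if y: "norm y < r" and e: "e > 0" for y e
  proof -
    have "x0 + y \<in> E n" "x0 - y \<in> E n" using r(2) y by (auto simp: dist_norm)
    then obtain a b where a: "norm (T a) \<le> real n" "dist a (x0 + y) < e"
      and b: "norm (T b) \<le> real n" "dist b (x0 - y) < e"
      using e unfolding E_def closure_approachable by blast
    \<comment> \<open>Half the difference of approximants to x0 + y and x0 - y moves the ball from
      x0 to the origin and keeps the bound n.\<close>
    define x where "x = (1/2) *\<^sub>R (a - b)"
    have "2 *\<^sub>R (y - x) = - (a - (x0 + y)) + (b - (x0 - y))"
      by (simp add: x_def scaleR_diff_right scaleR_2)
    then have "2 * norm (y - x) = norm (- (a - (x0 + y)) + (b - (x0 - y)))"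
      by (metis norm_scaleR abs_numeral)
    also have "\<dots> \<le> norm (- (a - (x0 + y))) + norm (b - (x0 - y))"
      by (rule norm_triangle_ineq)
    also have "\<dots> = dist a (x0 + y) + dist b (x0 - y)"
      unfolding norm_minus_cancel dist_norm ..
    finally have 1: "norm (y - x) < e" using a b by simp
    have "2 * norm (T x) = norm (T a - T b)" by (simp add: x_def T.scaleR T.diff)
    also have "\<dots> \<le> norm (T a) + norm (T b)" by (rule norm_triangle_ineq4)
    finally have "norm (T x) \<le> real n" using a b by simp
    with 1 show ?thesis by blast
  qed
  define K where "K = 2 * real n / r"
  have approx: "\<exists>x. norm (y - x) \<le> e \<and> norm (T x) \<le> K * norm y" if e: "e > 0" for e y
  proof (cases "y = 0")
    case True
    then show ?thesis using e by (intro exI[of _ 0]) (simp add: T.zero)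
  next
    case False
    \<comment> \<open>Dividing by \<open>s\<close> brings \<open>y\<close> to norm r/2, where
      \<open>near\<close> applies; scaling back multiplies the bound n by \<open>s\<close>, which is
      the origin of \<open>K\<close>.\<close>
    define s where "s = 2 * norm y / r"
    have s: "s > 0" using False r(1) by (simp add: s_def)
    have "norm ((1/s) *\<^sub>R y) < r" using False r(1) by (simp add: s_def)
    with near[of "(1/s) *\<^sub>R y" "e / s"] e s obtain x
      where x: "norm ((1/s) *\<^sub>R y - x) < e / s" "norm (T x) \<le> real n" by auto
    have "norm (y - s *\<^sub>R x) = s * norm ((1/s) *\<^sub>R y - x)"
      using s norm_scaleR[of s "(1/s) *\<^sub>R y - x"] by (simp add: scaleR_diff_right)
    also have "\<dots> \<le> e" using x(1) s by (simp add: field_simps)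
    finally have 1: "norm (y - s *\<^sub>R x) \<le> e" .
    have "norm (T (s *\<^sub>R x)) \<le> s * real n" using x(2) s by (simp add: T.scaleR)
    also have "\<dots> = K * norm y" by (simp add: s_def K_def)
    finally show ?thesis using 1 by blast
  qed
  define g where "g y e = (SOME x. norm (y - x) \<le> e \<and> norm (T x) \<le> K * norm y)" for y e
  have g: "norm (y - g y e) \<le> e" "norm (T (g y e)) \<le> K * norm y" if "e > 0" for y e
    using someI_ex[OF approx[OF that, of y]] by (simp_all add: g_def)
  have K0: "K \<ge> 0" using r(1) by (simp add: K_def)
  have "norm (T y) \<le> norm y * (2 * K)" for y
  proof (cases "y = 0")
    case True then show ?thesis by (simp add: T.zero)
  next
    case False
    define e where "e k = norm y * (1/2) ^ k" for k :: nat
    have e: "e k > 0" for k using False by (simp add: e_def)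
    \<comment> \<open>\<open>Y k\<close> is the remainder after k corrections. Tolerance
      \<open>e (Suc k)\<close> in step k keeps norm (Y k) at most \<open>e k\<close>, so the image
      of the k-th correction is at most K \<open>e k\<close>.\<close>
    define Y where "Y = rec_nat y (\<lambda>k v. v - g v (e (Suc k)))"
    have Y0: "Y 0 = y" and YS: "Y (Suc k) = Y k - g (Y k) (e (Suc k))" for k
      by (simp_all add: Y_def)
    have Ye: "norm (Y k) \<le> e k" for k
      by (cases k) (use g(1) e in \<open>auto simp: Y0 YS, simp add: e_def\<close>)
    define x where "x k = g (Y k) (e (Suc k))" for k
    have sumx: "(\<Sum>i<k. x i) = y - Y k" for k
      by (induction k) (simp_all add: Y0 YS x_def)
    have e0: "e \<longlonglongrightarrow> 0"
      unfolding e_def by (intro tendsto_mult_right_zero LIMSEQ_power_zero) auto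
    have "Y \<longlonglongrightarrow> 0"
      by (rule Lim_null_comparison[OF _ e0]) (use Ye in auto)
    then have lim: "(\<lambda>k. \<Sum>i<k. x i) \<longlonglongrightarrow> y"
      unfolding sumx using tendsto_diff[OF tendsto_const, of Y 0 sequentially y] by simp
    have Tx: "norm (T (x k)) \<le> K * e k" for k
      unfolding x_def by (rule order_trans[OF g(2)[OF e]]) (intro mult_left_mono Ye K0)
    have es: "(\<lambda>k. K * e k) sums (K * (norm y * 2))"
      unfolding e_def using geometric_sums[of "1/2::real"] by (intro sums_mult) auto
    then have "summable (\<lambda>k. norm (T (x k)))"
      using Tx by (intro summable_comparison_test'[OF sums_summable[OF es]]) auto
    then have sm: "summable (\<lambda>k. T (x k))" by (rule summable_norm_cancel)
    then have "(\<lambda>k. T (\<Sum>i<k. x i)) \<longlonglongrightarrow> (\<Sum>k. T (x k))"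
      unfolding T.sum using summable_LIMSEQ by blast
    from cl[OF lim this] have "norm (T y) = norm (\<Sum>k. T (x k))" by simp
    also have "\<dots> \<le> (\<Sum>k. norm (T (x k)))"
      by (rule summable_norm) fact
    also have "\<dots> \<le> (\<Sum>k. K * e k)"
      by (rule suminf_le) (use Tx \<open>summable (\<lambda>k. norm (T (x k)))\<close> sums_summable[OF es] in auto)
    also have "\<dots> = norm y * (2 * K)" using sums_unique[OF es] by (metis mult.assoc mult.commute)
    finally show ?thesis .
  qed
  then show ?thesis by (intro bounded_linear_intro) (auto simp: T.add T.scaleR)
qed

section \<open>Operators as partial maps\<close>

lemma op_of_graph_eq_Some_iff:
  "op_of_graph G x = Some y \<longleftrightarrow> (x, y) \<in> G \<and> (\<forall>y'. (x, y') \<in> G \<longrightarrow> y' = y)"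
proof
  assume *: "op_of_graph G x = Some y"
  then have ex: "\<exists>!y. (x, y) \<in> G" by (simp add: op_of_graph_def split: if_splits)
  with * have "y = (THE y. (x, y) \<in> G)" by (simp add: op_of_graph_def)
  with theI'[OF ex] ex show "(x, y) \<in> G \<and> (\<forall>y'. (x, y') \<in> G \<longrightarrow> y' = y)" by blast
next
  assume *: "(x, y) \<in> G \<and> (\<forall>y'. (x, y') \<in> G \<longrightarrow> y' = y)"
  then have "\<exists>!y. (x, y) \<in> G" "(THE y. (x, y) \<in> G) = y" by (blast, intro the_equality) auto
  then show "op_of_graph G x = Some y" by (simp add: op_of_graph_def)
qed

lemma op_eqI: "(\<And>x y. S x = Some y \<longleftrightarrow> T x = Some y) \<Longrightarrow> S = T"
  by (rule ext) (metis option.exhaust)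

lemma op_inv_eq_Some_iff:
  assumes "inj_on T (dom T)"
  shows "op_inv T y = Some x \<longleftrightarrow> T x = Some y"
  using assms by (auto simp: op_inv_def op_of_graph_eq_Some_iff graph_def inj_on_def dom_def)

lemma inj_on_dom_if_inverse:
  assumes "\<And>x y. T x = Some y \<longleftrightarrow> x = c y"
  shows "inj_on T (dom T)"
  using assms by (auto simp: inj_on_def dom_def) metis

lemma op_inv_total:
  assumes "\<And>x y. T x = Some y \<longleftrightarrow> x = c y"
  shows "op_inv T = (\<lambda>y. Some (c y))"
  by (rule op_eqI) (auto simp: op_inv_eq_Some_iff[OF inj_on_dom_if_inverse[of T c, OF assms]] assms)

lemma op_add_eq_Some_iff:
  "(S +\<^sub>o T) x = Some y \<longleftrightarrow> (\<exists>u v. S x = Some u \<and> T x = Some v \<and> y = u + v)"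
  by (auto simp: op_add_def)

lemma op_diff_eq_Some_iff:
  "(S -\<^sub>o T) x = Some y \<longleftrightarrow> (\<exists>u v. S x = Some u \<and> T x = Some v \<and> y = u - v)"
  by (auto simp: op_diff_def)

lemma op_scale_eq_Some_iff:
  "(c *\<^sub>o T) x = Some y \<longleftrightarrow> (\<exists>u. T x = Some u \<and> y = c *\<^sub>C u)"
  by (auto simp: op_scale_def)

lemma block_op_eq_Some_iff:
  "block_op S11 S12 S21 S22 (f, g) = Some (h, k) \<longleftrightarrow>
     (\<exists>a b c d. S11 f = Some a \<and> S12 g = Some b \<and> S21 f = Some c \<and> S22 g = Some d \<and>
       h = a + b \<and> k = c + d)"
  by (auto simp: block_op_def)

lemmas op_eq_Some_iff =
  op_add_eq_Some_iff op_diff_eq_Some_iff op_scale_eq_Some_iff map_comp_Some_iff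

lemma diff_zero_scale_op [simp]: "T -\<^sub>o 0 *\<^sub>o id_op = T"
  by (rule op_eqI) (auto simp: op_eq_Some_iff)

lemma in_graph_iff: "(x, y) \<in> Map.graph T \<longleftrightarrow> T x = Some y"
  by (simp add: Map.graph_def)

lemma linear_op_0: "linear_op T \<Longrightarrow> T 0 = Some 0"
  by (simp add: linear_op_def)

lemma linear_op_add: "linear_op T \<Longrightarrow> T x = Some u \<Longrightarrow> T y = Some v \<Longrightarrow> T (x + y) = Some (u + v)"
  by (simp add: linear_op_def)

lemma linear_op_scaleC: "linear_op T \<Longrightarrow> T x = Some u \<Longrightarrow> T (c *\<^sub>C x) = Some (c *\<^sub>C u)"
  by (simp add: linear_op_def)

lemma linear_op_scaleR: "linear_op T \<Longrightarrow> T x = Some u \<Longrightarrow> T (r *\<^sub>R x) = Some (r *\<^sub>R u)"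
  by (simp add: linear_op_scaleC scaleR_scaleC)

lemma linear_op_diff:
  assumes "linear_op T" "T x = Some u" "T y = Some v"
  shows "T (x - y) = Some (u - v)"
  using linear_op_add[OF assms(1,2) linear_op_scaleR[OF assms(1,3), of "-1"]] by simp

lemma linear_op_compose: "linear_op S \<Longrightarrow> linear_op T \<Longrightarrow> linear_op (S \<circ>\<^sub>m T)"
  unfolding linear_op_def map_comp_Some_iff by blast

lemma linear_op_scale: "linear_op T \<Longrightarrow> linear_op (c *\<^sub>o T)"
  by (auto simp: linear_op_def op_scale_eq_Some_iff scaleC_add_right scaleC_scaleC mult.commute)

lemma subspace_graph: "linear_op T \<Longrightarrow> subspace (Map.graph T)"
  by (rule subspaceI) (auto simp: in_graph_iff linear_op_0 linear_op_add linear_op_scaleR zero_prod_def)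

lemma closed_op_limit:
  assumes "closed_op T" "\<And>n. T (f n) = Some (g n)" "f \<longlonglongrightarrow> x" "g \<longlonglongrightarrow> y"
  shows "T x = Some y"
proof -
  have "(x, y) \<in> Map.graph T"
    using assms(1) unfolding closed_op_def
    by (rule closed_sequentially[of _ "\<lambda>n. (f n, g n)"]) (use assms in \<open>auto simp: in_graph_iff intro: tendsto_Pair\<close>)
  then show ?thesis by (simp add: in_graph_iff)
qed

text \<open>The total-map counterpart of \<open>bounded_ops\<close>: the calculus of real bounded
  linear maps applies, with complex homogeneity added.\<close>

definition bounded_clinear :: "('a::complex_inner \<Rightarrow> 'b::complex_inner) \<Rightarrow> bool" where
  "bounded_clinear c \<longleftrightarrow> bounded_linear c \<and> (\<forall>z x. c (z *\<^sub>C x) = z *\<^sub>C c x)"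

lemma bounded_ops_Some_iff: "(\<lambda>x. Some (c x)) \<in> bounded_ops \<longleftrightarrow> bounded_clinear c"
proof
  assume *: "(\<lambda>x. Some (c x)) \<in> bounded_ops"
  then obtain K where K: "\<And>x. norm (c x) \<le> K * norm x" by (auto simp: bounded_ops_def)
  have add: "c (x + y) = c x + c y" and scale: "c (z *\<^sub>C x) = z *\<^sub>C c x" for x y z
    using * by (auto simp: bounded_ops_def linear_op_def)
  have "bounded_linear c"
    by (rule bounded_linear_intro[of _ K])
      (use K in \<open>auto simp: add scaleR_scaleC scale mult.commute\<close>)
  with scale show "bounded_clinear c" by (simp add: bounded_clinear_def)
next
  assume *: "bounded_clinear c"
  then interpret c: bounded_linear c by (simp add: bounded_clinear_def)
  show "(\<lambda>x. Some (c x)) \<in> bounded_ops"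
    using * c.bounded by (auto simp: bounded_ops_def linear_op_def bounded_clinear_def c.zero c.add mult.commute)
qed

lemma bounded_opsE:
  assumes "T \<in> bounded_ops"
  obtains c where "bounded_clinear c" "T = (\<lambda>x. Some (c x))"
proof -
  have "T = (\<lambda>x. Some (the (T x)))"
    using assms by (intro ext) (auto simp: bounded_ops_def intro!: option.collapse[symmetric])
  with bounded_ops_Some_iff[of "\<lambda>x. the (T x)"] assms that show thesis by metis
qed

text \<open>The graph of \<open>T\<close> is the flipped graph of a continuous map.\<close>

lemma closed_op_if_inverse:
  assumes "bounded_clinear c" "\<And>x y. T x = Some y \<longleftrightarrow> x = c y"
  shows "closed_op T"
proof -
  have "Map.graph T = {p. fst p = c (snd p)}" using assms(2) by (auto simp: in_graph_iff)
  moreover have "closed {p. fst p = c (snd p)}"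
    using assms(1) unfolding bounded_clinear_def
    by (intro closed_Collect_eq continuous_intros bounded_linear.continuous_on[of c]) auto
  ultimately show ?thesis by (simp add: closed_op_def)
qed

text \<open>The lower bound yields injectivity and, at the same time, the bound 1/\<delta> for the
  inverse.\<close>

lemma bounded_inverse_exists:
  assumes T: "linear_op T" and surj: "\<And>y. \<exists>x. T x = Some y"
    and low: "\<And>x y. T x = Some y \<Longrightarrow> \<delta> * norm x \<le> norm y" and "\<delta> > 0"
  obtains c where "bounded_clinear c" "\<And>x y. T x = Some y \<longleftrightarrow> x = c y"
    "\<And>y. norm (c y) \<le> norm y / \<delta>"
proof -
  obtain c where c: "\<And>y. T (c y) = Some y" using surj by metis
  have inj: "x = x'" if "T x = Some y" "T x' = Some y" for x x' y
    using low[OF linear_op_diff[OF T that]] \<open>\<delta> > 0\<close> by (simp add: mult_le_0_iff)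
  have iff: "T x = Some y \<longleftrightarrow> x = c y" for x y using c inj by blast
  have 1: "c (x + y) = c x + c y" for x y using linear_op_add[OF T c c] iff by metis
  have 2: "c (z *\<^sub>C x) = z *\<^sub>C c x" for z x using linear_op_scaleC[OF T c] iff by metis
  have 3: "norm (c y) \<le> norm y / \<delta>" for y
    using low[OF c[of y]] \<open>\<delta> > 0\<close> by (simp add: field_simps)
  have "bounded_linear c"
    by (rule bounded_linear_intro[of _ "1/\<delta>"]) (use 3 in \<open>auto simp: 1 2 scaleR_scaleC\<close>)
  then have "bounded_clinear c" using 2 by (simp add: bounded_clinear_def)
  from this iff 3 show thesis by (rule that)
qed

text \<open>Continuation of surjectivity in the spectral parameter, by the contraction principle.\<close>

lemma surj_shift:
  fixes T :: "'a::chilbert_space \<rightharpoonup> 'a"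
  assumes T: "linear_op T" and surj: "\<And>h. \<exists>f k. T f = Some k \<and> \<mu> *\<^sub>R f + k = h"
    and low: "\<And>f k. T f = Some k \<Longrightarrow> \<delta> * norm f \<le> norm (\<mu> *\<^sub>R f + k)"
    and \<delta>: "\<bar>\<nu> - \<mu>\<bar> < \<delta>"
  shows "\<exists>f k. T f = Some k \<and> \<nu> *\<^sub>R f + k = h"
proof -
  obtain P K where P: "\<And>h. T (P h) = Some (K h)" "\<And>h. \<mu> *\<^sub>R P h + K h = h"
    using surj by metis
  have lip: "\<delta> * norm (P x - P y) \<le> norm (x - y)" for x y
  proof -
    have "\<mu> *\<^sub>R (P x - P y) + (K x - K y) = x - y"
      using P(2)[of x] P(2)[of y] by (simp add: scaleR_diff_right algebra_simps)
    then show ?thesis using low[OF linear_op_diff[OF T P(1) P(1)], of x y] by simp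
  qed
  \<comment> \<open>The equation \<nu> f + k = h reads \<mu> f + k = h + (\<mu> - \<nu>) f, so its
    solutions are the fixed points of \<open>F\<close>; the lower bound makes \<open>P\<close>
    Lipschitz with constant 1/\<delta>.\<close>
  define F where "F x = P (h + (\<mu> - \<nu>) *\<^sub>R x)" for x
  have d0: "\<delta> > 0" using \<delta> by linarith
  have "\<exists>!x. F x = x"
  proof (rule banach_fix_type)
    show "0 \<le> \<bar>\<nu> - \<mu>\<bar> / \<delta>" "\<bar>\<nu> - \<mu>\<bar> / \<delta> < 1" using \<delta> d0 by auto
    have "dist (F x) (F y) \<le> \<bar>\<nu> - \<mu>\<bar> / \<delta> * dist x y" for x y
    proof -
      have "\<delta> * norm (F x - F y) \<le> norm ((\<mu> - \<nu>) *\<^sub>R (x - y))"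
        unfolding F_def by (rule order_trans[OF lip]) (simp add: scaleR_diff_right)
      also have "\<dots> = \<bar>\<nu> - \<mu>\<bar> * norm (x - y)" by (simp add: abs_minus_commute)
      finally show ?thesis using d0 by (simp add: dist_norm field_simps)
    qed
    then show "\<forall>x y. dist (F x) (F y) \<le> \<bar>\<nu> - \<mu>\<bar> / \<delta> * dist x y" by blast
  qed
  then obtain x where x: "F x = x" by blast
  have "T x = Some (K (h + (\<mu> - \<nu>) *\<^sub>R x))" using P(1) x by (metis F_def)
  moreover have "\<mu> *\<^sub>R x + K (h + (\<mu> - \<nu>) *\<^sub>R x) = h + (\<mu> - \<nu>) *\<^sub>R x"
    using P(2) x by (metis F_def)
  then have "\<nu> *\<^sub>R x + K (h + (\<mu> - \<nu>) *\<^sub>R x) = h"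
    by (simp add: scaleR_diff_left algebra_simps)
  ultimately show ?thesis by blast
qed

section \<open>The operators \<open>A\<^sup>* A\<close> and \<open>|A|\<close>\<close>

lemma inner_dense_eq_0:
  assumes "closure D = UNIV" "\<And>f. f \<in> D \<Longrightarrow> inner h f = 0"
  shows "h = 0"
proof -
  have "closed {f. inner h f = 0}"
    by (intro closed_Collect_eq continuous_intros)
  then have "closure D \<subseteq> {f. inner h f = 0}" using assms(2) by (intro closure_minimal) auto
  then have "h \<in> {f. inner h f = 0}" using assms(1) by (metis UNIV_I subsetD)
  then have "inner h h = 0" by simp
  then show ?thesis by simp
qed

text \<open>Density makes \<open>h\<close> unique, so the single-valuedness built into
  \<open>op_of_graph\<close> holds and only the pairing condition remains.\<close>

lemma adj_eq_Some_iff: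
  assumes "densely_defined T"
  shows "adj T g = Some h \<longleftrightarrow> (\<forall>f u. T f = Some u \<longrightarrow> cinner g u = cinner h f)"
proof -
  have "h' = h" if "\<forall>f\<in>dom T. cinner g (the (T f)) = cinner h f"
    "\<forall>f\<in>dom T. cinner g (the (T f)) = cinner h' f" for h h'
  proof -
    have "h' - h = 0"
      by (rule inner_dense_eq_0[of "dom T"])
        (use assms that in \<open>auto simp: densely_defined_def inner_Re_cinner cinner_diff_left\<close>)
    then show ?thesis by simp
  qed
  then have "adj T g = Some h \<longleftrightarrow> (\<forall>f\<in>dom T. cinner g (the (T f)) = cinner h f)"
    unfolding adj_def op_of_graph_eq_Some_iff by auto
  also have "\<dots> \<longleftrightarrow> (\<forall>f u. T f = Some u \<longrightarrow> cinner g u = cinner h f)"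
    by (auto simp: dom_def)
  finally show ?thesis .
qed

lemma linear_op_adj:
  assumes "densely_defined T"
  shows "linear_op (adj T)"
  unfolding linear_op_def adj_eq_Some_iff[OF assms]
  by (auto simp: cinner_add_left cinner_scaleC_left)

locale dense_closed_op =
  fixes A :: "'h1::chilbert_space \<rightharpoonup> 'h2::chilbert_space"
  assumes lin: "linear_op A" and dense: "densely_defined A" and clos: "closed_op A"
begin

definition "AA = adj A \<circ>\<^sub>m A"

lemma AA_eq_Some_iff: "AA f = Some k \<longleftrightarrow> (\<exists>u. A f = Some u \<and> adj A u = Some k)"
  by (auto simp: AA_def map_comp_Some_iff)

lemma linear_AA: "linear_op AA"
  unfolding AA_def by (intro linear_op_compose linear_op_adj lin dense)

lemma AA_form: "A f = Some u \<Longrightarrow> adj A u = Some k \<Longrightarrow> A g = Some v \<Longrightarrow> cinner k g = cinner u v"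
  unfolding adj_eq_Some_iff[OF dense] by auto

lemma AA_symmetric: "AA f = Some k \<Longrightarrow> AA g = Some l \<Longrightarrow> cinner k g = cinner f l"
proof -
  assume "AA f = Some k" "AA g = Some l"
  then obtain u v where "A f = Some u" "adj A u = Some k" "A g = Some v" "adj A v = Some l"
    unfolding AA_eq_Some_iff by blast
  then have "cinner k g = cinner u v" "cinner l f = cinner v u"
    by (auto intro: AA_form)
  then show "cinner k g = cinner f l" using cinner_commute[of f l] cinner_commute[of u v] by simp
qed

text \<open>Project \<open>(h, 0)\<close> orthogonally onto the graph of \<open>A\<close>.\<close>

lemma one_plus_AA_surj: "\<exists>f k. AA f = Some k \<and> f + k = h"
proof -
  obtain p where p: "p \<in> Map.graph A" "\<And>v. v \<in> Map.graph A \<Longrightarrow> inner ((h, 0) - p) v = 0"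
    using orthogonal_projection_exists[OF subspace_graph[OF lin], of "(h, 0)"] clos
    unfolding closed_op_def by blast
  obtain f u where fu: "p = (f, u)" "A f = Some u" using p(1) by (cases p) (auto simp: in_graph_iff)
  have re: "inner (h - f) g = inner u v" if "A g = Some v" for g v
    using p(2)[of "(g, v)"] that by (simp add: fu in_graph_iff)
  \<comment> \<open>Orthogonality only gives real parts; testing with \<i> g as well supplies the
    imaginary part, so \<open>u\<close> lies in the domain of \<open>adj A\<close>.\<close>
  have "cinner u v = cinner (h - f) g" if "A g = Some v" for g v
    using re[OF that] re[OF linear_op_scaleC[OF lin that, of \<i>]]
    by (simp add: complex_eq_iff inner_Re_cinner[symmetric] Im_cinner)
  then have "adj A u = Some (h - f)" unfolding adj_eq_Some_iff[OF dense] by blast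
  then show ?thesis using fu by (intro exI[of _ f] exI[of _ "h - f"]) (auto simp: AA_eq_Some_iff)
qed

end

locale coercive_op = dense_closed_op A for A :: "'h1::chilbert_space \<rightharpoonup> 'h2::chilbert_space" +
  fixes \<epsilon> :: real
  assumes eps: "\<epsilon> > 0" and coercive: "nonneg_op (AA -\<^sub>o complex_of_real \<epsilon> *\<^sub>o id_op)"
begin

lemma AA_ge:
  assumes "AA f = Some k"
  shows "\<epsilon> * (norm f)\<^sup>2 \<le> inner f k"
proof -
  have "(AA -\<^sub>o complex_of_real \<epsilon> *\<^sub>o id_op) f = Some (k - complex_of_real \<epsilon> *\<^sub>C f)"
    using assms by (auto simp: op_eq_Some_iff)
  with coercive have "0 \<le> Re (cinner f (k - complex_of_real \<epsilon> *\<^sub>C f))"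
    unfolding nonneg_op_def by (metis domI option.sel)
  then show ?thesis
    by (simp add: cinner_diff_right cinner_scaleC_right cinner_self inner_Re_cinner)
qed

text \<open>Coercivity gives 1 + \<open>AA\<close> the lower bound 1 + \<epsilon>, strictly more
  than the distance from parameter 1 to parameter 0, so a single application of
  \<open>surj_shift\<close> reaches \<open>AA\<close> itself.\<close>

lemma AA_inverse:
  obtains B where "bounded_clinear B" "positive_symmetric B" "\<And>f k. AA f = Some k \<longleftrightarrow> f = B k"
proof -
  have low1: "(1 + \<epsilon>) * norm f \<le> norm (1 *\<^sub>R f + k)" if "AA f = Some k" for f k
  proof (cases "f = 0")
    case False
    have "(1 + \<epsilon>) * (norm f)\<^sup>2 \<le> inner f (f + k)"
      using AA_ge[OF that] by (simp add: inner_add_right power2_norm_eq_inner distrib_right)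
    also have "\<dots> \<le> norm f * norm (f + k)" by (rule norm_cauchy_schwarz)
    finally have "norm f * ((1 + \<epsilon>) * norm f) \<le> norm f * norm (f + k)"
      by (simp add: power2_eq_square mult_ac)
    with False show ?thesis by simp
  qed simp
  have surj: "\<exists>f. AA f = Some h" for h
    using surj_shift[OF linear_AA, of 1 "1 + \<epsilon>" 0 h] one_plus_AA_surj low1 eps by auto
  have low: "\<epsilon> * norm f \<le> norm k" if "AA f = Some k" for f k
  proof (cases "f = 0")
    case False
    have "\<epsilon> * (norm f)\<^sup>2 \<le> norm f * norm k"
      using AA_ge[OF that] norm_cauchy_schwarz by (rule order_trans)
    then have "norm f * (\<epsilon> * norm f) \<le> norm f * norm k" by (simp add: power2_eq_square mult_ac)
    with False show ?thesis by simp
  qed simp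
  obtain B where B: "bounded_clinear B" "\<And>f k. AA f = Some k \<longleftrightarrow> f = B k" "\<And>y. norm (B y) \<le> norm y / \<epsilon>"
    by (rule bounded_inverse_exists[OF linear_AA surj _ eps], erule low, rule that)
  have AAB: "AA (B h) = Some h" for h using B(2) by simp
  have "inner (B h) k = inner h (B k)" for h k
    using AA_symmetric[OF AAB AAB, of h k] by (simp add: inner_Re_cinner)
  moreover have "0 \<le> inner h (B h)" for h
    using AA_ge[OF AAB[of h]] eps order_trans[OF mult_nonneg_nonneg[of \<epsilon> "(norm (B h))\<^sup>2"]]
    by (simp add: inner_commute)
  ultimately have "positive_symmetric B" using B(1) by (simp add: positive_symmetric_def bounded_clinear_def)
  from B(1) this B(2) show thesis by (rule that)
qed

end

section \<open>Bounded complex-linear maps, bounded inverses and resolvents\<close>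

lemma bounded_clinear_zero: "bounded_clinear c \<Longrightarrow> c 0 = 0"
  by (simp add: bounded_clinear_def linear_simps)

lemma bounded_clinear_add: "bounded_clinear c \<Longrightarrow> c (x + y) = c x + c y"
  by (simp add: bounded_clinear_def linear_simps)

lemma bounded_clinear_diff: "bounded_clinear c \<Longrightarrow> c (x - y) = c x - c y"
  by (simp add: bounded_clinear_def linear_simps)

lemma bounded_clinear_minus: "bounded_clinear c \<Longrightarrow> c (- y) = - c y"
  by (simp add: bounded_clinear_def linear_simps)

lemma bounded_clinear_scaleC: "bounded_clinear c \<Longrightarrow> c (z *\<^sub>C x) = z *\<^sub>C c x"
  by (simp add: bounded_clinear_def)

lemma bounded_clinear_tendsto:
  "bounded_clinear c \<Longrightarrow> (f \<longlongrightarrow> l) F \<Longrightarrow> ((\<lambda>x. c (f x)) \<longlongrightarrow> c l) F"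
  by (auto simp: bounded_clinear_def intro: bounded_linear.tendsto)

lemmas bounded_clinear_simps =
  bounded_clinear_zero bounded_clinear_add bounded_clinear_diff bounded_clinear_minus bounded_clinear_scaleC

lemma bounded_clinear_compose:
  "bounded_clinear c \<Longrightarrow> bounded_clinear d \<Longrightarrow> bounded_clinear (\<lambda>x. c (d x))"
  by (auto simp: bounded_clinear_def intro: bounded_linear_compose)

lemma bounded_clinear_plus:
  "bounded_clinear c \<Longrightarrow> bounded_clinear d \<Longrightarrow> bounded_clinear (\<lambda>x. c x + d x)"
  by (auto simp: bounded_clinear_def scaleC_add_right intro: bounded_linear_add)

lemma bounded_clinear_scale: "bounded_clinear c \<Longrightarrow> bounded_clinear (\<lambda>x. z *\<^sub>C c x)"
  by (auto simp: bounded_clinear_def scaleC_scaleC mult.commute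
      intro: bounded_linear_compose[OF bounded_linear_scaleC])

lemma bounded_clinear_Pair:
  "bounded_clinear c \<Longrightarrow> bounded_clinear d \<Longrightarrow> bounded_clinear (\<lambda>x. (c x, d x))"
  by (auto simp: bounded_clinear_def scaleC_prod_def intro: bounded_linear_Pair)

lemma bounded_clinear_fst: "bounded_clinear fst" and bounded_clinear_snd: "bounded_clinear snd"
  by (auto simp: bounded_clinear_def scaleC_prod_def bounded_linear_fst bounded_linear_snd)

lemma bounded_clinear_Pair_zero: "bounded_clinear (\<lambda>x. (x, 0))"
  by (intro bounded_clinear_Pair) (auto simp: bounded_clinear_def)

lemma bounded_inverse_iff:
  "inj_on T (dom T) \<and> op_inv T \<in> bounded_ops \<longleftrightarrow>
     (\<exists>c. bounded_clinear c \<and> (\<forall>x y. T x = Some y \<longleftrightarrow> x = c y))"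
proof
  assume *: "inj_on T (dom T) \<and> op_inv T \<in> bounded_ops"
  then obtain c where c: "bounded_clinear c" "op_inv T = (\<lambda>x. Some (c x))" by (metis bounded_opsE)
  then show "\<exists>c. bounded_clinear c \<and> (\<forall>x y. T x = Some y \<longleftrightarrow> x = c y)"
    using op_inv_eq_Some_iff[of T, symmetric] * by (intro exI[of _ c]) auto
next
  assume "\<exists>c. bounded_clinear c \<and> (\<forall>x y. T x = Some y \<longleftrightarrow> x = c y)"
  then obtain c where c: "bounded_clinear c" "\<And>x y. T x = Some y \<longleftrightarrow> x = c y" by blast
  show "inj_on T (dom T) \<and> op_inv T \<in> bounded_ops"
    using inj_on_dom_if_inverse[of T c, OF c(2)] op_inv_total[of T c, OF c(2)] c(1)
      bounded_ops_Some_iff[of c] by simp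
qed

lemma resolvent_set_iff:
  "z \<in> resolvent_set T \<longleftrightarrow>
     (\<exists>c. bounded_clinear c \<and> (\<forall>x y. (T -\<^sub>o z *\<^sub>o id_op) x = Some y \<longleftrightarrow> x = c y))"
  by (simp add: resolvent_set_def bounded_inverse_iff)

lemma linear_op_if_inverse:
  assumes c: "bounded_clinear c" and T: "\<And>x y. T x = Some y \<longleftrightarrow> x = c y"
  shows "linear_op T"
  by (simp add: linear_op_def T bounded_clinear_simps[OF c])

text \<open>Flipping the closed graph of \<open>T\<close> gives the closed graph of the total map
  \<open>c\<close>, to which the closed graph theorem applies.\<close>

lemma bounded_clinear_if_inverse:
  fixes T :: "'a::chilbert_space \<rightharpoonup> 'b::chilbert_space"
  assumes T: "linear_op T" "closed_op T" and c: "\<And>x y. T x = Some y \<longleftrightarrow> x = c y"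
  shows "bounded_clinear c"
proof -
  have Tc: "T (c y) = Some y" for y using c by simp
  have add: "c (x + y) = c x + c y" for x y using linear_op_add[OF T(1) Tc Tc] c by metis
  have scale: "c (z *\<^sub>C x) = z *\<^sub>C c x" for z x using linear_op_scaleC[OF T(1) Tc] c by metis
  have "linear c" by (rule linearI) (simp_all add: add scaleR_scaleC scale)
  moreover have "c x = y" if "f \<longlonglongrightarrow> x" "(\<lambda>n. c (f n)) \<longlonglongrightarrow> y" for f x y
    using closed_op_limit[OF T(2) Tc that(2,1)] c by simp
  ultimately have "bounded_linear c" by (rule closed_graph_theorem)
  with scale show ?thesis by (simp add: bounded_clinear_def)
qed

lemma closed_op_shift:
  assumes "closed_op T"
  shows "closed_op (T -\<^sub>o z *\<^sub>o id_op)"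
  unfolding closed_op_def closed_sequential_limits
proof (intro allI impI, elim conjE)
  fix p l
  assume p: "\<forall>n. p n \<in> Map.graph (T -\<^sub>o z *\<^sub>o id_op)" and l: "p \<longlonglongrightarrow> l"
  have 1: "T (fst (p n)) = Some (snd (p n) + z *\<^sub>C fst (p n))" for n
  proof -
    have "(T -\<^sub>o z *\<^sub>o id_op) (fst (p n)) = Some (snd (p n))"
      using p by (simp flip: in_graph_iff)
    then show ?thesis by (auto simp: op_eq_Some_iff)
  qed
  have "T (fst l) = Some (snd l + z *\<^sub>C fst l)"
    by (rule closed_op_limit[OF assms 1, of "\<lambda>n. n"]) (intro tendsto_intros tendsto_scaleC l)+
  then show "l \<in> Map.graph (T -\<^sub>o z *\<^sub>o id_op)"
    by (cases l) (auto simp: in_graph_iff op_eq_Some_iff)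
qed

lemma linear_op_shift: "linear_op T \<Longrightarrow> linear_op (T -\<^sub>o z *\<^sub>o id_op)"
  unfolding linear_op_def op_eq_Some_iff
  by (fastforce simp: scaleC_add_right scaleC_diff_right scaleC_scaleC mult.commute)

section \<open>Operators with a bounded positive inverse\<close>

locale positive_inverse =
  fixes S :: "'a::chilbert_space \<rightharpoonup> 'a" and C :: "'a \<Rightarrow> 'a"
  assumes C: "bounded_clinear C" and pos: "positive_symmetric C"
    and S_iff: "\<And>x y. S x = Some y \<longleftrightarrow> x = C y"
begin

lemma S_C: "S (C y) = Some y"
  by (simp add: S_iff)

lemma C_inj: "C x = C y \<Longrightarrow> x = y"
  by (metis S_C option.inject)

lemma C_sym: "cinner (C x) y = cinner x (C y)"
  using pos by (simp add: complex_eq_iff inner_Re_cinner[symmetric] Im_cinner positive_symmetric_def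
      bounded_clinear_scaleC[OF C, symmetric])

lemma dom_S: "dom S = range C"
  by (auto simp: dom_def S_iff)

text \<open>If x is orthogonal to the range of \<open>C\<close>, then the squared norm of C x is the
  pairing of x with C (C x), hence 0, and \<open>C\<close> is injective.\<close>

lemma dense_dom_S: "densely_defined S"
  unfolding densely_defined_def dom_S
proof (rule dense_if_orthogonal_trivial)
  show "subspace (range C)"
    using C by (auto simp: bounded_clinear_def intro!: linear_subspace_image bounded_linear.linear)
  fix x assume x: "\<And>v. v \<in> range C \<Longrightarrow> inner x v = 0"
  have "inner (C x) (C x) = 0" using x pos by (simp add: positive_symmetric_def)
  then have "C x = C 0" by (simp add: bounded_clinear_zero[OF C])
  then show "x = 0" by (rule C_inj)
qed

lemma linear_S: "linear_op S"
  by (rule linear_op_if_inverse[OF C S_iff])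

text \<open>Writing the elements of dom S as C u turns the adjoint condition into the equality of g
  and C h paired with every u, which says g = C h.\<close>

lemma selfadjoint_S: "selfadjoint S"
proof -
  have "adj S g = Some h \<longleftrightarrow> S g = Some h" for g h
  proof -
    have "adj S g = Some h \<longleftrightarrow> (\<forall>u. cinner g u = cinner (C h) u)"
      by (simp add: adj_eq_Some_iff[OF dense_dom_S] S_iff C_sym)
    also have "\<dots> \<longleftrightarrow> g = C h"
      by (auto intro: inner_eqI simp: inner_Re_cinner)
    finally show ?thesis by (simp add: S_iff)
  qed
  then have "adj S = S" by (rule op_eqI)
  then show ?thesis using linear_S dense_dom_S by (simp add: selfadjoint_def)
qed

lemma nonneg_S: "nonneg_op S"
proof -
  have "cinner (C u) u \<in> \<real> \<and> 0 \<le> Re (cinner (C u) u)" for u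
    using C_sym[of u u] cinner_commute[of u "C u"] pos
    by (auto simp: Reals_cnj_iff positive_symmetric_def inner_Re_cinner[symmetric] inner_commute)
  then show ?thesis by (auto simp: nonneg_op_def dom_S S_C)
qed

end

section \<open>Existence, uniqueness and domain of |A|\<close>

context coercive_op
begin

text \<open>\<open>S\<close> is onto because its square is, and injective because its kernel lies in
  that of \<open>AA\<close>. Its total inverse \<open>c\<close> satisfies c c = B, is symmetric
  because \<open>S\<close> is selfadjoint, and is bounded because the squared norm of c x is the
  pairing of x with B x. So \<open>c\<close> is a positive root of \<open>B\<close>, and uniqueness
  for bounded operators applies.\<close>

lemma positive_sqrt_AA_unique:
  assumes S: "selfadjoint S" "nonneg_op S" "S \<circ>\<^sub>m S = AA"
    and B: "bounded_clinear B" "\<And>f k. AA f = Some k \<longleftrightarrow> f = B k"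
    and C: "positive_symmetric C" "\<And>x. C (C x) = B x"
  shows "S x = Some y \<longleftrightarrow> x = C y"
proof -
  have lin: "linear_op S" and dd: "densely_defined S" and adjS: "adj S = S"
    using S(1) by (auto simp: selfadjoint_def)
  have SS: "AA f = Some k \<longleftrightarrow> (\<exists>u. S f = Some u \<and> S u = Some k)" for f k
    unfolding S(3)[symmetric] by (auto simp: map_comp_Some_iff)
  have "\<exists>x. S x = Some y" for y using SS[of "B y" y] B(2) by auto
  then obtain c where c: "\<And>y. S (c y) = Some y" by metis
  have inj: "x = x'" if "S x = Some y" "S x' = Some y" for x x' y
  proof -
    have "S (x - x') = Some 0" using linear_op_diff[OF lin that] by simp
    then have "AA (x - x') = Some 0" using SS linear_op_0[OF lin] by blast
    then show ?thesis using B by (simp add: bounded_clinear_zero)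
  qed
  have iff: "S x = Some y \<longleftrightarrow> x = c y" for x y using c inj by blast
  have add: "c (x + y) = c x + c y" for x y using linear_op_add[OF lin c c] iff by metis
  have scale: "c (r *\<^sub>R x) = r *\<^sub>R c x" for r x using linear_op_scaleR[OF lin c] iff by metis
  have sym: "cinner (c x) y = cinner x (c y)" for x y
  proof -
    have "adj S (c x) = Some x" by (simp add: adjS c)
    then show ?thesis using c[of y] by (simp add: adj_eq_Some_iff[OF dd])
  qed
  have cc: "c (c x) = B x" for x using SS c B(2) by metis
  have "0 \<le> Re (cinner (c x) x)" for x
    using S(2) c[of x] unfolding nonneg_op_def by (metis domI option.sel)
  then have nonneg: "0 \<le> inner x (c x)" for x by (simp add: inner_Re_cinner sym)
  obtain k where k: "k > 0" "\<And>x. norm (B x) \<le> norm x * k"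
    using B(1) bounded_linear.pos_bounded unfolding bounded_clinear_def by blast
  have bound: "norm (c x) \<le> norm x * sqrt k" for x
  proof -
    have "(norm (c x))\<^sup>2 = inner x (B x)"
      by (simp add: power2_norm_eq_inner inner_Re_cinner sym cc)
    also have "\<dots> \<le> norm x * norm (B x)" by (rule norm_cauchy_schwarz)
    also have "\<dots> \<le> norm x * (norm x * k)" by (intro mult_left_mono k) auto
    also have "\<dots> = (norm x * sqrt k)\<^sup>2" using k(1) by (simp add: power2_eq_square mult_ac)
    finally show ?thesis by (rule power2_le_imp_le) (use k(1) in simp)
  qed
  have "bounded_linear c" by (rule bounded_linear_intro[OF add scale bound])
  then have "positive_symmetric c"
    using nonneg by (simp add: positive_symmetric_def inner_Re_cinner sym)
  then have "c = C" by (rule positive_sqrt_unique[OF _ C(1)]) (simp add: cc C(2))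
  with iff show ?thesis by simp
qed

lemma abs_inverse:
  obtains C where "positive_inverse (op_abs A) C" "\<And>f k. AA f = Some k \<longleftrightarrow> f = C (C k)"
proof -
  obtain B where B: "bounded_clinear B" "positive_symmetric B" "\<And>f k. AA f = Some k \<longleftrightarrow> f = B k"
    using AA_inverse by blast
  obtain C where Cs: "positive_symmetric C" "\<And>x. C (C x) = B x"
    "\<And>L x. bounded_linear L \<Longrightarrow> (\<And>x. L (B x) = B (L x)) \<Longrightarrow> L (C x) = C (L x)"
    using positive_sqrt_exists[OF B(2)] by blast
  \<comment> \<open>The root was built as a real-linear map; multiplication by \<open>z\<close>
    commutes with \<open>B\<close>, hence with \<open>C\<close>.\<close>
  have "z *\<^sub>C C x = C (z *\<^sub>C x)" for z x
    by (rule Cs(3)[OF bounded_linear_scaleC]) (simp add: bounded_clinear_scaleC[OF B(1)])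
  then have Cb: "bounded_clinear C" using Cs(1) by (simp add: bounded_clinear_def positive_symmetric_def)
  have inj: "x = y" if "C x = C y" for x y
  proof -
    have "AA (B x) = Some x" "AA (B x) = Some y" using B(3) that Cs(2) by metis+
    then show ?thesis by simp
  qed
  define S where "S = op_inv (\<lambda>x. Some (C x))"
  have "S x = Some y \<longleftrightarrow> x = C y" for x y
    unfolding S_def by (subst op_inv_eq_Some_iff) (auto simp: inj_on_def dest: inj)
  then interpret positive_inverse S C using Cb Cs(1) by unfold_locales auto
  have sq: "S \<circ>\<^sub>m S = AA"
    by (rule op_eqI) (auto simp: map_comp_Some_iff S_iff B(3) Cs(2))
  have "op_abs A = S"
    unfolding op_abs_def op_sqrt_def AA_def[symmetric]
  proof (rule the_equality)
    fix S' assume "selfadjoint S' \<and> nonneg_op S' \<and> S' \<circ>\<^sub>m S' = AA"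
    then have "S' x = Some y \<longleftrightarrow> x = C y" for x y
      using positive_sqrt_AA_unique[of S' B C x y] B Cs by simp
    then show "S' = S" by (intro op_eqI) (simp add: S_iff)
  qed (simp add: selfadjoint_S nonneg_S sq)
  then show thesis using that[of C] positive_inverse_axioms B(3) Cs(2) by simp
qed

text \<open>On the vectors \<open>C (C w)\<close>, whose images under \<open>|A|\<close> are dense, \<open>A\<close> and \<open>|A|\<close> have the
  same norm; closedness of \<open>A\<close> then extends its domain.\<close>

lemma dom_abs_subset: "dom (op_abs A) \<subseteq> dom A"
proof -
  obtain C where PI: "positive_inverse (op_abs A) C" and AA: "\<And>f k. AA f = Some k \<longleftrightarrow> f = C (C k)"
    by (rule abs_inverse) (rule that)
  interpret positive_inverse "op_abs A" C by (rule PI)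
  have "C y \<in> dom A" for y
  proof -
    \<comment> \<open>Replace \<open>y\<close> by vectors C (w n) tending to it: then C (C (w n))
      lies in dom A and tends to C y, and only the convergence of its images under A remains to be
      shown.\<close>
    have "y \<in> closure (range C)" using dense_dom_S by (simp add: densely_defined_def dom_S)
    then obtain s where s: "\<And>n. s n \<in> range C" "s \<longlonglongrightarrow> y" unfolding closure_sequential by blast
    have "\<exists>w. s n = C w" for n using s(1)[of n] by blast
    then obtain w where w: "\<And>n. s n = C (w n)" by metis
    have "\<exists>u. A (C (C v)) = Some u \<and> adj A u = Some v" for v
      using AA[of "C (C v)" v] by (simp add: AA_eq_Some_iff)
    then obtain U where U: "\<And>v. A (C (C v)) = Some (U v)" "\<And>v. adj A (U v) = Some v" by metis
    have diff: "U v - U v' = U (v - v')" for v v'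
    proof -
      have "A (C (C (v - v'))) = Some (U v - U v')"
        using linear_op_diff[OF lin U(1) U(1)] by (simp add: bounded_clinear_diff[OF C])
      then show ?thesis using U(1) by simp
    qed
    have nrm: "norm (U v) = norm (C v)" for v
    proof -
      have "cinner v (C (C v)) = cinner (U v) (U v)" by (rule AA_form[OF U(1) U(2) U(1)])
      then have "cinner (C v) (C v) = cinner (U v) (U v)" by (simp add: C_sym)
      then have "(norm (C v))\<^sup>2 = (norm (U v))\<^sup>2" unfolding cinner_self of_real_eq_iff .
      then show ?thesis by simp
    qed
    have "dist (U (w m)) (U (w n)) = dist (s m) (s n)" for m n
      by (simp add: dist_norm diff nrm w bounded_clinear_diff[OF C])
    then have "Cauchy (\<lambda>n. U (w n))"
      using LIMSEQ_imp_Cauchy[OF s(2)] by (simp add: Cauchy_def)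
    then obtain u where u: "(\<lambda>n. U (w n)) \<longlonglongrightarrow> u"
      using Cauchy_convergent convergent_def by blast
    have "(\<lambda>n. C (C (w n))) \<longlonglongrightarrow> C y"
      using bounded_clinear_tendsto[OF C s(2)] by (simp add: w)
    from closed_op_limit[OF clos U(1) this u] show ?thesis by blast
  qed
  then show ?thesis by (auto simp: dom_S)
qed

end

section \<open>The block operator \<open>Q\<close> and the pencil \<open>M\<close>\<close>

locale damped_op = positive_inverse S C for S :: "'a::chilbert_space \<rightharpoonup> 'a" and C +
  fixes R :: "'a \<rightharpoonup> 'a"
  assumes linear_R: "linear_op R" and closable_R: "closable_op R" and dom_R: "dom S \<subseteq> dom R"
begin

definition "K y = the (R (C y))"

lemma R_C: "R (C y) = Some (K y)"
proof -
  have "C y \<in> dom R" using dom_R by (auto simp: dom_S)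
  then show ?thesis by (auto simp: K_def)
qed

text \<open>If f n tends to x and K (f n) to y, then (C x, y) lies in the closure of the graph of
  \<open>R\<close>. Closability says that this closure is again a graph, so y = K x.\<close>

lemma bounded_K: "bounded_clinear K"
proof -
  have add: "K (x + y) = K x + K y" for x y
    using linear_op_add[OF linear_R R_C R_C, of x y] R_C[of "x + y"] by (simp add: bounded_clinear_add[OF C])
  have scale: "K (z *\<^sub>C x) = z *\<^sub>C K x" for z x
    using linear_op_scaleC[OF linear_R R_C, of z x] R_C[of "z *\<^sub>C x"] by (simp add: bounded_clinear_scaleC[OF C])
  have "linear K" by (rule linearI) (simp_all add: add scaleR_scaleC scale)
  moreover have "K x = y" if "f \<longlonglongrightarrow> x" "(\<lambda>n. K (f n)) \<longlonglongrightarrow> y" for f x y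
  proof -
    obtain T :: "'a \<rightharpoonup> 'a" where T: "closure (Map.graph R) = Map.graph T"
      using closable_R unfolding closable_op_def by blast
    have "(C (f n), K (f n)) \<in> Map.graph R" for n by (simp add: in_graph_iff R_C)
    moreover have "(\<lambda>n. (C (f n), K (f n))) \<longlonglongrightarrow> (C x, y)"
      by (intro tendsto_Pair bounded_clinear_tendsto[OF C] that)
    ultimately have "(C x, y) \<in> Map.graph T" unfolding T[symmetric] closure_sequential
      by (intro exI[of _ "\<lambda>n. (C (f n), K (f n))"]) auto
    moreover have "(C x, K x) \<in> Map.graph T"
      unfolding T[symmetric] by (rule subsetD[OF closure_subset]) (simp add: in_graph_iff R_C)
    ultimately show ?thesis by (simp add: in_graph_iff)
  qed
  ultimately have "bounded_linear K" by (rule closed_graph_theorem)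
  with scale show ?thesis by (simp add: bounded_clinear_def)
qed

lemmas C_simps = bounded_clinear_simps[OF C]
lemmas K_simps = bounded_clinear_simps[OF bounded_K]

abbreviation "Q \<equiv> Q_op S R"
abbreviation "M \<equiv> M_pencil S R"

definition "Q_inv p = (C (snd p), C (fst p) + \<i> *\<^sub>C C (K (snd p)))"

lemma Q_eq_Some_iff: "Q x = Some y \<longleftrightarrow> x = Q_inv y"
proof -
  have "Q (f, g) = Some (h, k) \<longleftrightarrow> (f, g) = Q_inv (h, k)" for f g h k
  proof -
    have "Q (f, g) = Some (h, k) \<longleftrightarrow>
      (\<exists>a b. f = C k \<and> R f = Some a \<and> g = C b \<and> h = (- \<i>) *\<^sub>C a + b)"
      by (auto simp: Q_op_def block_op_eq_Some_iff op_eq_Some_iff S_iff)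
    also have "\<dots> \<longleftrightarrow> f = C k \<and> g = C (h + \<i> *\<^sub>C K k)"
      by (auto simp: R_C intro!: exI[where P="\<lambda>b. C (h + \<i> *\<^sub>C K k) = C b \<and> _ b" and x="h + \<i> *\<^sub>C K k"])
    finally show ?thesis by (simp add: Q_inv_def C_simps)
  qed
  then show ?thesis by (metis surj_pair)
qed

lemma bounded_Q_inv: "bounded_clinear Q_inv"
  unfolding Q_inv_def
  by (intro bounded_clinear_Pair bounded_clinear_plus bounded_clinear_scale
      bounded_clinear_compose[OF C] bounded_clinear_compose[OF bounded_K]
      bounded_clinear_fst bounded_clinear_snd)

lemma linear_Q: "linear_op Q"
  by (rule linear_op_if_inverse[OF bounded_Q_inv Q_eq_Some_iff])

lemma closed_Q: "closed_op Q"
  by (rule closed_op_if_inverse[OF bounded_Q_inv Q_eq_Some_iff])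

text \<open>Here \<open>b\<close> is |A| g and \<open>k'\<close> is |A| f; with these parameters no
  domain condition is left.\<close>

lemma Q_shift_eq_Some_iff:
  "(Q -\<^sub>o z *\<^sub>o id_op) (f, g) = Some (h, k) \<longleftrightarrow>
    (\<exists>b k'. f = C k' \<and> g = C b \<and> h = b - \<i> *\<^sub>C K k' - z *\<^sub>C f \<and> k = k' - z *\<^sub>C g)"
proof -
  have "(Q -\<^sub>o z *\<^sub>o id_op) (f, g) = Some (h, k) \<longleftrightarrow>
     (\<exists>h' k'. f = C k' \<and> g = C (h' + \<i> *\<^sub>C K k') \<and> h = h' - z *\<^sub>C f \<and> k = k' - z *\<^sub>C g)"
    by (auto simp: op_eq_Some_iff Q_eq_Some_iff Q_inv_def C_simps scaleC_prod_def)
  also have "\<dots> \<longleftrightarrow> (\<exists>b k'. f = C k' \<and> g = C b \<and> h = b - \<i> *\<^sub>C K k' - z *\<^sub>C f \<and> k = k' - z *\<^sub>C g)"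
    by (metis add_diff_cancel_right' diff_add_cancel)
  finally show ?thesis .
qed

lemma M_eq_Some_iff:
  "M z f = Some h \<longleftrightarrow> (\<exists>w. f = C (C w) \<and> h = w - (\<i> * z) *\<^sub>C K (C w) - z\<^sup>2 *\<^sub>C f)"
  by (auto simp: M_pencil_def op_eq_Some_iff S_iff R_C)

text \<open>Substituting f = C (k + z g) from the second row into the first leaves M(z) (C g) = h +
  i K k + z C k, which determines C g and hence g. The map \<open>s\<close> is |A| \<open>m\<close>;
  its boundedness is obtained later from that of the whole resolvent.\<close>

lemma Q_shift_inverse_if_M_inverse:
  assumes m: "bounded_clinear m" "\<And>f h. M z f = Some h \<longleftrightarrow> f = m h"
  obtains s where "\<And>x. m x = C (s x)"
    "\<And>p q. (Q -\<^sub>o z *\<^sub>o id_op) p = Some q \<longleftrightarrow>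
       p = (C (snd q) + z *\<^sub>C m (fst q + \<i> *\<^sub>C K (snd q) + z *\<^sub>C C (snd q)),
            s (fst q + \<i> *\<^sub>C K (snd q) + z *\<^sub>C C (snd q)))"
proof -
  have "M z (m x) = Some x" for x using m(2) by simp
  then have "\<exists>w. m x = C (C w) \<and> x = w - (\<i> * z) *\<^sub>C K (C w) - z\<^sup>2 *\<^sub>C m x" for x
    unfolding M_eq_Some_iff .
  \<comment> \<open>\<open>w x\<close> is |A|^2 applied to \<open>m x\<close>, so that C (w x) is
    |A| applied to \<open>m x\<close>.\<close>
  then obtain w where w: "\<And>x. m x = C (C (w x))"
    "\<And>x. x = w x - (\<i> * z) *\<^sub>C K (C (w x)) - z\<^sup>2 *\<^sub>C m x" by metis
  define s where "s x = C (w x)" for x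
  define N where "N q = (C (snd q) + z *\<^sub>C m (fst q + \<i> *\<^sub>C K (snd q) + z *\<^sub>C C (snd q)),
      s (fst q + \<i> *\<^sub>C K (snd q) + z *\<^sub>C C (snd q)))" for q
  have sol: "(Q -\<^sub>o z *\<^sub>o id_op) (N q) = Some q" for q
  proof -
    obtain h k where q: "q = (h, k)" by (cases q)
    define x where "x = h + \<i> *\<^sub>C K k + z *\<^sub>C C k"
    have N: "N q = (C k + z *\<^sub>C m x, s x)" by (simp add: N_def q x_def)
    have "h = x - \<i> *\<^sub>C K k - z *\<^sub>C C k" by (simp add: x_def)
    also have "x = w x - (\<i> * z) *\<^sub>C K (C (w x)) - z\<^sup>2 *\<^sub>C m x" by (rule w(2))
    finally have "h = w x - \<i> *\<^sub>C K (k + z *\<^sub>C s x) - z *\<^sub>C (C k + z *\<^sub>C m x)"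
      by (simp add: s_def K_simps scaleC_add_right scaleC_scaleC power2_eq_square algebra_simps)
    moreover have "C k + z *\<^sub>C m x = C (k + z *\<^sub>C s x)" by (simp add: s_def C_simps w(1))
    ultimately show ?thesis
      unfolding N unfolding q Q_shift_eq_Some_iff
      by (intro exI[of _ "w x"] exI[of _ "k + z *\<^sub>C s x"]) (simp add: s_def)
  qed
  have inj: "p = 0" if p: "(Q -\<^sub>o z *\<^sub>o id_op) p = Some 0" for p
  proof -
    obtain f g where fg: "p = (f, g)" by (cases p)
    obtain b k' where b: "f = C k'" "g = C b" "0 = b - \<i> *\<^sub>C K k' - z *\<^sub>C f" "0 = k' - z *\<^sub>C g"
      using p unfolding fg zero_prod_def Q_shift_eq_Some_iff by blast
    have k': "k' = z *\<^sub>C C b" using b by simp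
    then have f: "f = z *\<^sub>C C (C b)" using b(1) by (simp add: C_simps)
    have "M z (C (C b)) = Some 0"
      unfolding M_eq_Some_iff using b(3)
      by (intro exI[of _ b]) (simp add: k' f K_simps scaleC_scaleC power2_eq_square)
    then have cc: "C (C b) = 0" using m by (simp add: bounded_clinear_zero)
    then have "C b = 0" using C_inj[of "C b" 0] by (simp add: C_simps)
    then show ?thesis using cc by (simp add: fg f b(2) zero_prod_def)
  qed
  have "(Q -\<^sub>o z *\<^sub>o id_op) p = Some q \<longleftrightarrow> p = N q" for p q
    using sol[of q] inj[of "p - N q"] linear_op_diff[OF linear_op_shift[OF linear_Q], of z p q "N q" q]
    by (metis diff_self eq_iff_diff_eq_0)
  then show thesis using that[of s] by (simp add: w(1) s_def N_def)
qed

text \<open>For right-hand sides (h, 0) the solution is (z f, |A| f) with M(z) f = h. Recovering f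
  from the second component, not the first, covers z = 0.\<close>

lemma M_inverse_if_Q_shift_inverse:
  assumes N: "bounded_clinear N" "\<And>p q. (Q -\<^sub>o z *\<^sub>o id_op) p = Some q \<longleftrightarrow> p = N q"
  shows "M z f = Some h \<longleftrightarrow> f = C (snd (N (h, 0)))"
proof
  assume "M z f = Some h"
  then obtain w where w: "f = C (C w)" "h = w - (\<i> * z) *\<^sub>C K (C w) - z\<^sup>2 *\<^sub>C f"
    unfolding M_eq_Some_iff by blast
  have "(Q -\<^sub>o z *\<^sub>o id_op) (z *\<^sub>C f, C w) = Some (h, 0)"
    unfolding Q_shift_eq_Some_iff
    by (intro exI[of _ w] exI[of _ "z *\<^sub>C C w"])
      (simp add: w C_simps K_simps scaleC_scaleC power2_eq_square)
  then have "N (h, 0) = (z *\<^sub>C f, C w)" using N(2) by simp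
  then show "f = C (snd (N (h, 0)))" by (simp add: w)
next
  assume f: "f = C (snd (N (h, 0)))"
  obtain f' g where N0: "N (h, 0) = (f', g)" by (cases "N (h, 0)")
  have "(Q -\<^sub>o z *\<^sub>o id_op) (f', g) = Some (h, 0)" using N(2) N0 by simp
  then obtain b k' where b: "f' = C k'" "g = C b" "h = b - \<i> *\<^sub>C K k' - z *\<^sub>C f'" "0 = k' - z *\<^sub>C g"
    unfolding Q_shift_eq_Some_iff by blast
  have k': "k' = z *\<^sub>C C b" using b by simp
  have "f = C (C b)" by (simp add: f N0 b(2))
  then show "M z f = Some h"
    unfolding M_eq_Some_iff
    by (intro exI[of _ b]) (simp add: b(1-3) k' C_simps K_simps scaleC_scaleC power2_eq_square)
qed

text \<open>From Q to M the inverse is a composition of bounded maps. In the other direction the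
  explicit solution is everywhere defined, and its boundedness follows because Q - z is linear and
  closed.\<close>

lemma resolvent_set_Q:
  "resolvent_set Q = {\<zeta>. inj_on (M \<zeta>) (dom (M \<zeta>)) \<and> op_inv (M \<zeta>) \<in> bounded_ops}"
proof -
  have "z \<in> resolvent_set Q \<longleftrightarrow>
      (\<exists>m. bounded_clinear m \<and> (\<forall>f h. M z f = Some h \<longleftrightarrow> f = m h))" for z
    unfolding resolvent_set_iff
  proof
    assume "\<exists>N. bounded_clinear N \<and> (\<forall>p q. (Q -\<^sub>o z *\<^sub>o id_op) p = Some q \<longleftrightarrow> p = N q)"
    then obtain N where N: "bounded_clinear N" "\<And>p q. (Q -\<^sub>o z *\<^sub>o id_op) p = Some q \<longleftrightarrow> p = N q"
      by blast
    have "bounded_clinear (\<lambda>h. C (snd (N (h, 0))))"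
      by (intro bounded_clinear_compose[OF C] bounded_clinear_compose[OF bounded_clinear_snd]
          bounded_clinear_compose[OF N(1)] bounded_clinear_Pair_zero)
    then show "\<exists>m. bounded_clinear m \<and> (\<forall>f h. M z f = Some h \<longleftrightarrow> f = m h)"
      using M_inverse_if_Q_shift_inverse[OF N] by blast
  next
    assume "\<exists>m. bounded_clinear m \<and> (\<forall>f h. M z f = Some h \<longleftrightarrow> f = m h)"
    then obtain m where m: "bounded_clinear m" "\<And>f h. M z f = Some h \<longleftrightarrow> f = m h" by blast
    obtain s where "\<And>x. m x = C (s x)" and s: "\<And>p q. (Q -\<^sub>o z *\<^sub>o id_op) p = Some q \<longleftrightarrow>
       p = (C (snd q) + z *\<^sub>C m (fst q + \<i> *\<^sub>C K (snd q) + z *\<^sub>C C (snd q)),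
            s (fst q + \<i> *\<^sub>C K (snd q) + z *\<^sub>C C (snd q)))"
      by (rule Q_shift_inverse_if_M_inverse[OF m]) (rule that)
    show "\<exists>N. bounded_clinear N \<and> (\<forall>p q. (Q -\<^sub>o z *\<^sub>o id_op) p = Some q \<longleftrightarrow> p = N q)"
      using bounded_clinear_if_inverse[OF linear_op_shift[OF linear_Q] closed_op_shift[OF closed_Q] s] s
      by blast
  qed
  then show ?thesis unfolding bounded_inverse_iff by blast
qed

lemma op_inv_S: "op_inv S = (\<lambda>y. Some (C y))"
  by (rule op_inv_total) (rule S_iff)

text \<open>All four blocks are total on their natural domains: the range of \<open>C\<close> lies
  in dom R and that of M(z)^-1 in dom |A|. Both sides can then be compared pointwise.\<close>

lemma op_inv_Q_shift:
  assumes "z \<in> resolvent_set Q"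
  shows "op_inv (Q -\<^sub>o z *\<^sub>o id_op) =
          block_op
            (z *\<^sub>o op_inv (M z))
            (op_inv S +\<^sub>o (op_inv (M z) \<circ>\<^sub>m ((\<i> * z) *\<^sub>o R +\<^sub>o z\<^sup>2 *\<^sub>o id_op) \<circ>\<^sub>m op_inv S))
            (S \<circ>\<^sub>m op_inv (M z))
            (S \<circ>\<^sub>m op_inv (M z) \<circ>\<^sub>m (\<i> *\<^sub>o R +\<^sub>o z *\<^sub>o id_op) \<circ>\<^sub>m op_inv S)"
    (is "_ = ?B")
proof -
  obtain m where m: "bounded_clinear m" "\<And>f h. M z f = Some h \<longleftrightarrow> f = m h"
    using assms unfolding resolvent_set_Q bounded_inverse_iff by blast
  obtain s where s: "\<And>x. m x = C (s x)" "\<And>p q. (Q -\<^sub>o z *\<^sub>o id_op) p = Some q \<longleftrightarrow>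
       p = (C (snd q) + z *\<^sub>C m (fst q + \<i> *\<^sub>C K (snd q) + z *\<^sub>C C (snd q)),
            s (fst q + \<i> *\<^sub>C K (snd q) + z *\<^sub>C C (snd q)))"
    by (rule Q_shift_inverse_if_M_inverse[OF m]) (rule that)
  have s_add: "s (x + y) = s x + s y" for x y
    by (rule C_inj) (simp add: s(1)[symmetric] C_simps bounded_clinear_add[OF m(1)])
  have op_inv_M: "op_inv (M z) = (\<lambda>h. Some (m h))"
    by (rule op_inv_total) (rule m(2))
  have Sm: "S (m x) = Some (s x)" for x by (simp add: s(1) S_C)
  have S_comb: "S (z *\<^sub>C m (C k) + \<i> *\<^sub>C m (K k)) = Some (s (z *\<^sub>C C k) + s (\<i> *\<^sub>C K k))" for k
    by (simp add: S_iff C_simps s(1)[symmetric] bounded_clinear_scaleC[OF m(1)])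
  have "?B (h, k) = Some (C k + z *\<^sub>C m (h + \<i> *\<^sub>C K k + z *\<^sub>C C k), s (h + \<i> *\<^sub>C K k + z *\<^sub>C C k))" for h k
    unfolding block_op_eq_Some_iff op_inv_M op_inv_S
    by (auto simp: op_eq_Some_iff R_C Sm S_comb s_add bounded_clinear_simps[OF m(1)]
        scaleC_add_right scaleC_scaleC power2_eq_square add_ac mult_ac)
  moreover have "op_inv (Q -\<^sub>o z *\<^sub>o id_op) = (\<lambda>q. Some
       (C (snd q) + z *\<^sub>C m (fst q + \<i> *\<^sub>C K (snd q) + z *\<^sub>C C (snd q)),
            s (fst q + \<i> *\<^sub>C K (snd q) + z *\<^sub>C C (snd q))))"
    by (rule op_inv_total) (rule s(2))
  ultimately show ?thesis by (intro ext) auto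
qed

lemma op_inv_Q: "op_inv Q = (\<lambda>q. Some (Q_inv q))"
  by (rule op_inv_total) (rule Q_eq_Some_iff)

lemma op_inv_Q_block:
  "op_inv Q = block_op zero_op (op_inv S) (op_inv S) (\<i> *\<^sub>o (op_inv S \<circ>\<^sub>m R \<circ>\<^sub>m op_inv S))"
  unfolding op_inv_Q op_inv_S Q_inv_def
  by (rule ext) (auto simp: block_op_def op_scale_def R_C)

lemma zero_in_resolvent_set_Q: "0 \<in> resolvent_set Q"
  using bounded_Q_inv Q_eq_Some_iff by (auto simp: resolvent_set_iff)

text \<open>The off-diagonal entries contribute \<i> times the sum of a number and its conjugate,
  which is purely imaginary; the real part is that of the form of \<open>R\<close> at the first
  component.\<close>

lemma accretive_iQ:
  assumes "accretive R"
  shows "accretive (\<i> *\<^sub>o Q)"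
proof -
  have "0 \<le> Re (cinner x (\<i> *\<^sub>C y))" if "Q x = Some y" for x y
  proof -
    obtain h k where y: "y = (h, k)" by (cases y)
    define b where "b = h + \<i> *\<^sub>C K k"
    have h: "h = b - \<i> *\<^sub>C K k" by (simp add: b_def)
    have x: "x = (C k, C b)" using that by (simp add: Q_eq_Some_iff Q_inv_def y b_def C_simps)
    have "cinner x (\<i> *\<^sub>C y) = cinner (C k) (K k) + \<i> * (cinner (C k) b + cinner (C b) k)"
      by (simp add: x y h cinner_prod_def scaleC_prod_def cinner_scaleC_right cinner_diff_right algebra_simps)
    moreover have "cinner (C b) k = cnj (cinner (C k) b)"
      by (simp add: C_sym cinner_commute[of _ b])
    moreover have "0 \<le> Re (cinner (C k) (K k))"
      using assms R_C[of k] unfolding accretive_def by (metis domI option.sel)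
    ultimately show ?thesis by simp
  qed
  then show ?thesis by (auto simp: accretive_def op_scale_def dom_def)
qed

lemma densely_defined_Q: "densely_defined Q"
proof -
  have "dom Q = dom S \<times> dom S" by (rule dom_Q_op[OF dom_R])
  then show ?thesis using dense_dom_S by (simp add: densely_defined_def closure_Times)
qed

end

section \<open>Contraction semigroups\<close>

text \<open>The exponential series applied to \<open>x\<close>. Its derived series, shifted by one
  index, is \<open>B\<close> of the series itself, and a uniform majorant on bounded intervals
  permits termwise differentiation.\<close>

lemma bounded_linear_ode_solution:
  fixes B :: "'a::banach \<Rightarrow> 'a"
  assumes "bounded_linear B"
  obtains u :: "real \<Rightarrow> 'a" where "u 0 = x" "\<And>t. (u has_vector_derivative B (u t)) (at t)"
proof -
  interpret B: bounded_linear B by fact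
  obtain k where k: "k > 0" "\<And>y. norm (B y) \<le> norm y * k" using B.pos_bounded by blast
  define c where "c i = (1 / fact i) *\<^sub>R (B ^^ i) x" for i :: nat
  have pow: "norm ((B ^^ i) x) \<le> k ^ i * norm x" for i
  proof (induction i)
    case (Suc i)
    have "norm ((B ^^ Suc i) x) \<le> norm ((B ^^ i) x) * k" using k(2) by simp
    also have "\<dots> \<le> (k ^ i * norm x) * k" by (intro mult_right_mono Suc.IH) (use k in auto)
    finally show ?case by (simp add: mult_ac)
  qed simp
  have cB: "real (Suc i) *\<^sub>R c (Suc i) = B (c i)" for i
    by (simp add: c_def B.scaleR)
  \<comment> \<open>For i = 0 the exponent truncates to 0, but the factor \<open>real i\<close>
    annihilates the term.\<close>
  define d where "d i t = (real i * t ^ (i - 1)) *\<^sub>R c i" for i and t :: real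
  have d_Suc: "d (Suc i) t = B (t ^ i *\<^sub>R c i)" for i t
    by (simp add: d_def B.scaleR flip: cB)
  have c_le: "norm (t ^ i *\<^sub>R c i) \<le> (inverse (fact i) * (r * k) ^ i) * norm x"
    if "\<bar>t\<bar> \<le> r" for i r and t :: real
  proof -
    have "norm (t ^ i *\<^sub>R c i) = \<bar>t\<bar> ^ i * (inverse (fact i) * norm ((B ^^ i) x))"
      by (simp add: c_def power_abs inverse_eq_divide)
    also have "\<dots> \<le> r ^ i * (inverse (fact i) * (k ^ i * norm x))"
      using that by (intro mult_mono power_mono pow) (auto intro: mult_nonneg_nonneg)
    finally show ?thesis by (simp add: power_mult_distrib mult_ac)
  qed
  have summ: "summable (\<lambda>i. (inverse (fact i) * (r * k) ^ i) * norm x)" for r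
    by (intro summable_mult2 summable_exp)
  have sums_c: "summable (\<lambda>i. t ^ i *\<^sub>R c i)" for t
    by (rule summable_comparison_test'[OF summ[of "\<bar>t\<bar>"], of 0]) (rule c_le, simp)
  define u where "u t = (\<Sum>i. t ^ i *\<^sub>R c i)" for t
  have sum_d: "(\<Sum>i. d i t) = B (u t)" for t
  proof -
    have "(\<lambda>i. d (Suc i) t) sums B (u t)"
      unfolding d_Suc u_def by (intro B.sums summable_sums sums_c)
    then have "(\<lambda>i. d i t) sums (B (u t) + d 0 t)" by (rule sums_Suc)
    then show ?thesis by (simp add: d_def sums_iff)
  qed
  have deriv: "(u has_vector_derivative B (u t)) (at t)" for t
  proof -
    define r where "r = \<bar>t\<bar> + 1"
    have t: "t \<in> {-r<..<r}" by (auto simp: r_def)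
    define m where "m i = (case i of 0 \<Rightarrow> 0 | Suc i \<Rightarrow> (inverse (fact i) * (r * k) ^ i) * norm x * k)" for i
    have "summable (\<lambda>i. m (Suc i))" using summable_mult2[OF summ] by (simp add: m_def)
    then have sm: "summable m" by (simp only: summable_Suc_iff)
    have "norm (d i s) \<le> m i" if "s \<in> {-r<..<r}" for i s
    proof (cases i)
      case (Suc j)
      have "norm (d (Suc j) s) \<le> norm (s ^ j *\<^sub>R c j) * k" unfolding d_Suc by (rule k(2))
      also have "\<dots> \<le> ((inverse (fact j) * (r * k) ^ j) * norm x) * k"
        by (intro mult_right_mono c_le) (use that k in auto)
      finally show ?thesis by (simp add: Suc m_def)
    qed (simp add: d_def m_def)
    then have ul: "uniform_limit {-r<..<r} (\<lambda>n s. \<Sum>i<n. d i s) (\<lambda>s. B (u s)) sequentially"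
      using Weierstrass_m_test[of "{-r<..<r}" d m] sm by (simp add: sum_d)
    have "\<exists>g. \<forall>s\<in>{-r<..<r}. (\<lambda>i. s ^ i *\<^sub>R c i) sums g s \<and>
        (g has_derivative (\<lambda>h. h *\<^sub>R B (u s))) (at s within {-r<..<r})"
    proof (rule has_derivative_series[where f' = "\<lambda>i s h. h *\<^sub>R d i s"])
      show "((\<lambda>s. s ^ i *\<^sub>R c i) has_derivative (\<lambda>h. h *\<^sub>R d i s)) (at s within {-r<..<r})" for i s
        unfolding d_def by (rule derivative_eq_intros refl)+ (auto simp: mult_ac)
      show "\<forall>\<^sub>F n in sequentially. \<forall>s\<in>{-r<..<r}. \<forall>h.
          norm ((\<Sum>i<n. h *\<^sub>R d i s) - h *\<^sub>R B (u s)) \<le> e * norm h" if "e > 0" for e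
      proof (rule eventually_mono[OF uniform_limitD[OF ul that]], intro ballI allI)
        fix n s h assume *: "\<forall>s\<in>{-r<..<r}. dist (\<Sum>i<n. d i s) (B (u s)) < e" "s \<in> {-r<..<r}"
        have "norm ((\<Sum>i<n. h *\<^sub>R d i s) - h *\<^sub>R B (u s)) = \<bar>h\<bar> * dist (\<Sum>i<n. d i s) (B (u s))"
          by (simp add: dist_norm scaleR_diff_right[symmetric] scaleR_right.sum[symmetric])
        also have "\<dots> \<le> \<bar>h\<bar> * e" using * by (intro mult_left_mono) (auto intro: less_imp_le)
        finally show "norm ((\<Sum>i<n. h *\<^sub>R d i s) - h *\<^sub>R B (u s)) \<le> e * norm h" by (simp add: mult.commute)
      qed
    qed (use t summable_sums[OF sums_c] in auto)
    then obtain g where g: "\<And>s. s \<in> {-r<..<r} \<Longrightarrow> (\<lambda>i. s ^ i *\<^sub>R c i) sums g s"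
      "(g has_derivative (\<lambda>h. h *\<^sub>R B (u t))) (at t within {-r<..<r})" using t by blast
    have gu: "g s = u s" if "s \<in> {-r<..<r}" for s
      using g(1)[OF that] by (simp add: u_def sums_iff)
    have "(u has_derivative (\<lambda>h. h *\<^sub>R B (u t))) (at t within {-r<..<r})"
      by (rule has_derivative_transform[OF t _ g(2)]) (simp add: gu)
    then show ?thesis
      using at_within_open[OF t open_greaterThanLessThan] by (simp add: has_vector_derivative_def)
  qed
  have "u 0 = x" unfolding u_def using suminf_finite[of "{0}" "\<lambda>i. 0 ^ i *\<^sub>R c i"] by (simp add: c_def)
  from that[OF this deriv] show thesis .
qed

text \<open>The derivative of the squared norm is twice the pairing of u with u', so 2 c t minus
  that square is nondecreasing. The case c = 0 gives contractivity and uniqueness, small c the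
  comparison of two approximations.\<close>

lemma norm_sq_growth:
  fixes u :: "real \<Rightarrow> 'a::real_inner"
  assumes der: "\<And>s. (u has_vector_derivative u' s) (at s)"
    and le: "\<And>s. 0 \<le> s \<Longrightarrow> inner (u s) (u' s) \<le> c" and "0 \<le> t"
  shows "(norm (u t))\<^sup>2 \<le> (norm (u 0))\<^sup>2 + 2 * c * t"
proof -
  have D: "((\<lambda>s. 2 * c * s - inner (u s) (u s)) has_real_derivative (2 * c - 2 * inner (u s) (u' s))) (at s)" for s
  proof -
    have "((\<lambda>s. inner (u s) (u s)) has_derivative (\<lambda>h. inner (u s) (h *\<^sub>R u' s) + inner (h *\<^sub>R u' s) (u s))) (at s)"
      using der[of s] by (intro has_derivative_inner) (auto simp: has_vector_derivative_def)
    then have "((\<lambda>s. inner (u s) (u s)) has_real_derivative (2 * inner (u s) (u' s))) (at s)"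
      unfolding has_field_derivative_def by (rule has_derivative_eq_rhs) (auto simp: inner_commute fun_eq_iff)
    then show ?thesis by (auto intro!: derivative_eq_intros)
  qed
  have "2 * c * 0 - inner (u 0) (u 0) \<le> 2 * c * t - inner (u t) (u t)"
    using \<open>0 \<le> t\<close>
    by (rule DERIV_nonneg_imp_nondecreasing) (use D le in force)
  then show ?thesis by (simp add: power2_norm_eq_inner)
qed

section \<open>Generation by maximal dissipative operators (Lumer-Phillips)\<close>

locale maximal_dissipative =
  fixes G :: "'a::chilbert_space \<rightharpoonup> 'a"
  assumes linear_G: "linear_op G" and dense_G: "densely_defined G"
    and dissipative: "\<And>f k. G f = Some k \<Longrightarrow> inner f k \<le> 0"
    and range: "\<And>l h. l > 0 \<Longrightarrow> \<exists>f k. G f = Some k \<and> l *\<^sub>R f - k = h"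
begin

lemma resolvent_lower_bound:
  assumes "G f = Some k" "l > 0"
  shows "l * norm f \<le> norm (k - l *\<^sub>R f)"
proof (cases "f = 0")
  case False
  have "norm f * (l * norm f) = l * inner f f" by (simp add: power2_norm_eq_inner[symmetric] power2_eq_square)
  also have "\<dots> \<le> inner f (l *\<^sub>R f - k)" using dissipative[OF assms(1)] by (simp add: inner_diff_right)
  also have "\<dots> \<le> norm f * norm (l *\<^sub>R f - k)" by (rule norm_cauchy_schwarz)
  finally have "norm f * (l * norm f) \<le> norm f * norm (l *\<^sub>R f - k)" .
  then show ?thesis using False by (simp add: norm_minus_commute)
qed simp

text \<open>The shift by one keeps the parameter positive from index 0 on.\<close>

definition lam :: "nat \<Rightarrow> real" where "lam n = real (Suc n)"

lemma lam_pos: "lam n > 0" by (simp add: lam_def)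

text \<open>\<open>J\<close> is l (l - G)^-1 with l = \<open>lam n\<close>. The last two clauses
  read l (J - 1) in two ways: as G J on the whole space and as J G on dom G.\<close>

lemma J_exists:
  "\<exists>J. bounded_clinear J \<and> (\<forall>x. norm (J x) \<le> norm x) \<and> (\<forall>x. G (J x) = Some (lam n *\<^sub>R (J x - x))) \<and>
    (\<forall>x y. G x = Some y \<longrightarrow> lam n *\<^sub>R (J x - x) = J y)"
proof -
  define l where "l = lam n"
  have l: "l > 0" by (simp add: l_def lam_pos)
  define T where "T = G -\<^sub>o complex_of_real l *\<^sub>o id_op"
  have T: "T f = Some w \<longleftrightarrow> (\<exists>k. G f = Some k \<and> w = k - l *\<^sub>R f)" for f w
    by (auto simp: T_def op_eq_Some_iff scaleR_scaleC)
  have lin: "linear_op T" unfolding T_def by (rule linear_op_shift[OF linear_G])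
  have surj: "\<exists>f. T f = Some w" for w
  proof -
    obtain f k where "G f = Some k" "l *\<^sub>R f - k = - w" using range[OF l] by blast
    then show ?thesis unfolding T by (intro exI[of _ f] exI[of _ k]) (auto simp: algebra_simps)
  qed
  have low: "l * norm f \<le> norm w" if "T f = Some w" for f w
    using that resolvent_lower_bound[OF _ l] by (auto simp: T)
  obtain c where c: "bounded_clinear c" "\<And>f w. T f = Some w \<longleftrightarrow> f = c w" "\<And>w. norm (c w) \<le> norm w / l"
    by (rule bounded_inverse_exists[OF lin surj _ l], erule low, rule that)
  \<comment> \<open>\<open>c\<close> inverts G - l, so the factor -l produces l (l - G)^-1.\<close>
  define J where "J x = complex_of_real (- l) *\<^sub>C c x" for x
  have J: "bounded_clinear J" unfolding J_def by (rule bounded_clinear_scale[OF c(1)])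
  have Jc: "J x = c ((- l) *\<^sub>R x)" for x by (simp add: J_def scaleR_scaleC bounded_clinear_simps[OF c(1)])
  have "norm (J x) \<le> norm x" for x
    using c(3)[of "(- l) *\<^sub>R x"] l by (simp add: Jc)
  moreover have "G (J x) = Some (l *\<^sub>R (J x - x))" for x
  proof -
    have "T (J x) = Some ((- l) *\<^sub>R x)" using c(2) by (simp add: Jc)
    then obtain k where "G (J x) = Some k" "(- l) *\<^sub>R x = k - l *\<^sub>R J x" by (auto simp: T)
    then show ?thesis by (simp add: scaleR_diff_right algebra_simps)
  qed
  moreover have "l *\<^sub>R (J x - x) = J y" if "G x = Some y" for x y
  proof -
    have "x = c (y - l *\<^sub>R x)" using that c(2) T by blast
    also have "\<dots> = c y + J x"
      by (simp add: Jc bounded_clinear_diff[OF c(1)] bounded_clinear_minus[OF c(1)])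
    finally have "J x - x = - c y" by (simp add: algebra_simps)
    then have "l *\<^sub>R (J x - x) = - (l *\<^sub>R c y)" by simp
    then show ?thesis by (simp add: J_def scaleR_scaleC)
  qed
  ultimately show ?thesis using J unfolding l_def by blast
qed

definition "J n = (SOME J. bounded_clinear J \<and> (\<forall>x. norm (J x) \<le> norm x) \<and>
  (\<forall>x. G (J x) = Some (lam n *\<^sub>R (J x - x))) \<and> (\<forall>x y. G x = Some y \<longrightarrow> lam n *\<^sub>R (J x - x) = J y))"

text \<open>The Yosida approximation of \<open>G\<close>.\<close>

definition "Y n x = lam n *\<^sub>R (J n x - x)"

lemma J_bounded: "bounded_clinear (J n)"
  and J_norm: "norm (J n x) \<le> norm x"
  and G_J: "G (J n x) = Some (Y n x)"
  and Y_eq_J: "G x = Some y \<Longrightarrow> Y n x = J n y"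
  using someI_ex[OF J_exists[of n]] unfolding J_def[symmetric] Y_def by auto

lemma Y_bounded: "bounded_clinear (Y n)"
proof -
  have "Y n = (\<lambda>x. complex_of_real (lam n) *\<^sub>C J n x + complex_of_real (- lam n) *\<^sub>C x)"
    by (rule ext) (simp add: Y_def scaleR_scaleC scaleC_diff_right)
  moreover have "bounded_clinear \<dots>"
    by (intro bounded_clinear_plus bounded_clinear_scale J_bounded) (simp add: bounded_clinear_def)
  ultimately show ?thesis by simp
qed

lemma Y_bounded_linear: "bounded_linear (Y n)"
  using Y_bounded by (simp add: bounded_clinear_def)

text \<open>Splits \<open>x\<close> into a point of dom G, where dissipativity can be used, and a
  rest with the factor 1/\<open>lam n\<close>.\<close>

lemma id_eq_J_minus_Y: "x = J n x - (1 / lam n) *\<^sub>R Y n x"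
  using lam_pos[of n] by (simp add: Y_def)

lemma Y_dissipative: "inner x (Y n x) \<le> 0"
proof -
  have "inner x (Y n x) = inner (J n x) (Y n x) - (1 / lam n) * inner (Y n x) (Y n x)"
    by (subst (1) id_eq_J_minus_Y[of x n]) (simp only: inner_diff_left inner_scaleR_left)
  also have "\<dots> \<le> 0 - 0"
    using dissipative[OF G_J] lam_pos[of n] by (intro diff_mono) auto
  finally show ?thesis by simp
qed

lemma norm_Y_le: "G x = Some y \<Longrightarrow> norm (Y n x) \<le> norm y"
  using Y_eq_J J_norm by simp

lemma dense_approx:
  assumes "e > 0"
  obtains x' y' where "G x' = Some y'" "norm (x - x') < e"
proof -
  have "x \<in> closure (dom G)" using dense_G by (simp add: densely_defined_def)
  then obtain x' where "x' \<in> dom G" "dist x' x < e" using assms closure_approachable by blast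
  then show thesis using that by (auto simp: dist_norm norm_minus_commute)
qed

text \<open>On dom G the distance of J x to x is at most norm (G x)/\<open>lam n\<close>; density
  and contractivity of \<open>J n\<close> extend the convergence.\<close>

lemma J_tendsto: "(\<lambda>n. J n x) \<longlonglongrightarrow> x"
proof (rule metric_LIMSEQ_I)
  fix e :: real assume e: "e > 0"
  obtain x' y' where x': "G x' = Some y'" "norm (x - x') < e / 3"
    using dense_approx[of "e / 3" x] e by auto
  obtain N :: nat where N: "norm y' / (e / 3) < real N" using reals_Archimedean2 by blast
  have "dist (J n x) x < e" if "n \<ge> N" for n
  proof -
    have "norm y' / (e/3) < lam n" using N that by (simp add: lam_def)
    then have "norm y' < (e / 3) * lam n" using e by (simp add: field_simps)
    moreover have "lam n * norm (J n x' - x') \<le> norm y'"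
      using norm_Y_le[OF x'(1), of n] lam_pos[of n] by (simp add: Y_def)
    ultimately have "lam n * norm (J n x' - x') < lam n * (e / 3)" by (simp add: mult.commute)
    then have 1: "norm (J n x' - x') < e / 3" using lam_pos[of n] by simp
    have "J n x - x = J n (x - x') + (J n x' - x') + (x' - x)"
      by (simp add: bounded_clinear_diff[OF J_bounded])
    then have "norm (J n x - x) \<le> norm (J n (x - x')) + norm (J n x' - x') + norm (x' - x)"
      by (metis norm_triangle_le norm_triangle_ineq add_right_mono order_refl)
    also have "\<dots> < e" using 1 x'(2) J_norm[of n "x - x'"] by (simp add: norm_minus_commute)
    finally show ?thesis by (simp add: dist_norm)
  qed
  then show "\<exists>N. \<forall>n\<ge>N. dist (J n x) x < e" by blast
qed

text \<open>This is exp (t Y) x for Y = \<open>Y n\<close>, chosen as a solution of the differential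
  equation.\<close>

definition "E n x = (SOME u. u 0 = x \<and> (\<forall>t. (u has_vector_derivative Y n (u t)) (at t)))"

lemma E_0: "E n x 0 = x" and E_deriv: "(E n x has_vector_derivative Y n (E n x t)) (at t)"
proof -
  have "\<exists>u. u 0 = x \<and> (\<forall>t. (u has_vector_derivative Y n (u t)) (at t))"
    using bounded_linear_ode_solution[OF Y_bounded_linear] by metis
  from someI_ex[OF this] show "E n x 0 = x" "(E n x has_vector_derivative Y n (E n x t)) (at t)"
    unfolding E_def by auto
qed

text \<open>The difference of two solutions is a solution starting at 0, and dissipativity keeps its
  norm from growing. Linearity, commutation and the semigroup law of \<open>E\<close> are all
  instances of this uniqueness.\<close>

lemma E_unique:
  assumes "\<And>t. (u has_vector_derivative Y n (u t)) (at t)" "0 \<le> t"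
  shows "u t = E n (u 0) t"
proof -
  have "((\<lambda>s. u s - E n (u 0) s) has_vector_derivative Y n (u s - E n (u 0) s)) (at s)" for s
    using has_vector_derivative_diff[OF assms(1)[of s] E_deriv[of n "u 0" s]]
    by (simp add: bounded_clinear_diff[OF Y_bounded])
  from norm_sq_growth[OF this Y_dissipative assms(2)] show ?thesis by (simp add: E_0)
qed

lemma E_contraction:
  assumes "0 \<le> t"
  shows "norm (E n x t) \<le> norm x"
proof -
  have "(norm (E n x t))\<^sup>2 \<le> (norm (E n x 0))\<^sup>2 + 2 * 0 * t"
    by (rule norm_sq_growth[OF E_deriv[of n x] Y_dissipative assms])
  then have "(norm (E n x t))\<^sup>2 \<le> (norm x)\<^sup>2" unfolding E_0 by simp
  then show ?thesis by (rule power2_le_imp_le) (rule norm_ge_zero)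
qed

lemma E_add: "0 \<le> t \<Longrightarrow> E n (x + y) t = E n x t + E n y t"
  using E_unique[of "\<lambda>s. E n x s + E n y s" n t] has_vector_derivative_add[OF E_deriv[of n x] E_deriv[of n y]]
  by (simp add: E_0 bounded_clinear_add[OF Y_bounded])

lemma E_bounded_clinear:
  assumes "bounded_clinear c" "\<And>x. c (Y n x) = Y n (c x)" "0 \<le> t"
  shows "c (E n x t) = E n (c x) t"
  using E_unique[of "\<lambda>s. c (E n x s)" n t] assms
    bounded_linear.has_vector_derivative[OF _ E_deriv[of n x], of c]
  by (simp add: E_0 bounded_clinear_def)

lemma E_scaleC: "0 \<le> t \<Longrightarrow> E n (z *\<^sub>C x) t = z *\<^sub>C E n x t"
  by (rule E_bounded_clinear[symmetric])
    (auto simp: bounded_clinear_scaleC[OF Y_bounded] bounded_clinear_def bounded_linear_scaleC scaleC_scaleC mult.commute)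

lemma E_diff: "0 \<le> t \<Longrightarrow> E n (x - y) t = E n x t - E n y t"
  using E_add[of t n x "- y"] E_scaleC[of t n "-1" y] by simp

lemma Y_E: "0 \<le> t \<Longrightarrow> Y n (E n x t) = E n (Y n x) t"
  by (rule E_bounded_clinear[OF Y_bounded]) auto

lemma E_semigroup: "0 \<le> s \<Longrightarrow> E n x (s + t) = E n (E n x t) s"
proof -
  assume "0 \<le> s"
  have "((\<lambda>r. E n x (r + t)) has_vector_derivative Y n (E n x (r + t))) (at r)" for r
    using vector_diff_chain_at[of "\<lambda>r. r + t" 1 r "E n x" "Y n (E n x (r + t))"] E_deriv
    by (simp add: o_def has_vector_derivative_add_const)
  from E_unique[OF this \<open>0 \<le> s\<close>] show ?thesis by simp
qed

text \<open>By \<open>id_eq_J_minus_Y\<close> the difference of the solutions is a difference of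
  points of dom G plus a rest. The images of these points under G differ by exactly the derivative,
  so this part pairs to at most 0; the rest is of order 1/\<open>lam n\<close> +
  1/\<open>lam m\<close>, as both derivatives stay bounded by norm y.\<close>

lemma E_cauchy_estimate:
  assumes xy: "G x = Some y" and t: "0 \<le> t"
  shows "(norm (E n x t - E m x t))\<^sup>2 \<le> 4 * (1 / lam n + 1 / lam m) * (norm y)\<^sup>2 * t"
proof -
  define a where "a s = Y n (E n x s)" for s
  define b where "b s = Y m (E m x s)" for s
  define q where "q = 1 / lam n + 1 / lam m"
  have der: "((\<lambda>s. E n x s - E m x s) has_vector_derivative a s - b s) (at s)" for s
    unfolding a_def b_def by (intro has_vector_derivative_diff E_deriv)
  have "inner (E n x s - E m x s) (a s - b s) \<le> 2 * q * (norm y)\<^sup>2" if s: "0 \<le> s" for s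
  proof -
    have Ya: "norm (Y k (E k x s)) \<le> norm y" for k
      unfolding Y_E[OF s] using E_contraction[OF s] norm_Y_le[OF xy] by (rule order_trans)
    have a: "norm (a s) \<le> norm y" and b: "norm (b s) \<le> norm y" by (simp_all add: a_def b_def Ya)
    have eq: "E n x s - E m x s =
        (J n (E n x s) - J m (E m x s)) - ((1 / lam n) *\<^sub>R a s - (1 / lam m) *\<^sub>R b s)"
      using id_eq_J_minus_Y[of "E n x s" n] id_eq_J_minus_Y[of "E m x s" m]
      unfolding a_def b_def by (simp add: algebra_simps)
    have "inner (J n (E n x s) - J m (E m x s)) (a s - b s) \<le> 0"
      unfolding a_def b_def by (rule dissipative[OF linear_op_diff[OF linear_G G_J G_J]])
    then have "inner (E n x s - E m x s) (a s - b s)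
        \<le> - inner ((1 / lam n) *\<^sub>R a s - (1 / lam m) *\<^sub>R b s) (a s - b s)"
      by (simp only: eq inner_diff_left[of "J n (E n x s) - J m (E m x s)"])
    also have "\<dots> = inner (- ((1 / lam n) *\<^sub>R a s - (1 / lam m) *\<^sub>R b s)) (a s - b s)" by (simp only: inner_minus_left)
    also have "\<dots> \<le> norm (- ((1 / lam n) *\<^sub>R a s - (1 / lam m) *\<^sub>R b s)) * norm (a s - b s)"
      by (rule norm_cauchy_schwarz)
    also have "\<dots> \<le> (q * norm y) * (2 * norm y)"
    proof (rule mult_mono)
      have "norm (- ((1 / lam n) *\<^sub>R a s - (1 / lam m) *\<^sub>R b s)) \<le> norm ((1 / lam n) *\<^sub>R a s) + norm ((1 / lam m) *\<^sub>R b s)"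
        unfolding norm_minus_cancel by (rule norm_triangle_ineq4)
      also have "\<dots> = (1 / lam n) * norm (a s) + (1 / lam m) * norm (b s)"
        using lam_pos[of n] lam_pos[of m] by simp
      also have "\<dots> \<le> (1 / lam n) * norm y + (1 / lam m) * norm y"
        using a b lam_pos[of n] lam_pos[of m] by (intro add_mono mult_left_mono) auto
      also have "\<dots> = q * norm y" by (simp add: q_def distrib_right)
      finally show "norm (- ((1 / lam n) *\<^sub>R a s - (1 / lam m) *\<^sub>R b s)) \<le> q * norm y" .
      show "norm (a s - b s) \<le> 2 * norm y"
        using norm_triangle_ineq4[of "a s" "b s"] a b by linarith
      show "0 \<le> q * norm y" using lam_pos[of n] lam_pos[of m] by (simp add: q_def)
    qed simp
    also have "\<dots> = 2 * q * (norm y)\<^sup>2" by (simp add: power2_eq_square)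
    finally show ?thesis .
  qed
  from norm_sq_growth[OF der this t] show ?thesis unfolding q_def[symmetric] by (simp add: E_0 mult.assoc)
qed

lemma E_uniformly_Cauchy: "uniformly_Cauchy_on {0..b} (\<lambda>n. E n x)"
proof (rule uniformly_Cauchy_onI)
  fix e :: real assume e: "e > 0"
  obtain x' y' where x': "G x' = Some y'" "norm (x - x') < e / 4"
    using dense_approx[of "e / 4" x] e by auto
  \<comment> \<open>With both parameters replaced by \<open>lam N\<close> and t by \<bar>b\<bar>,
    the bound of \<open>E_cauchy_estimate\<close> equals c/\<open>lam N\<close>.\<close>
  define c where "c = 8 * (norm y')\<^sup>2 * \<bar>b\<bar>"
  obtain N :: nat where N: "c / (e / 4)\<^sup>2 < real N" using reals_Archimedean2 by blast
  have "dist (E m x t) (E n x t) < e" if t: "t \<in> {0..b}" and mn: "m \<ge> N" "n \<ge> N" for t m n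
  proof -
    have t0: "0 \<le> t" "t \<le> \<bar>b\<bar>" using t by auto
    have N0: "lam N > 0" "real N < lam N" by (simp_all add: lam_def)
    have l: "1 / lam m \<le> 1 / lam N" "1 / lam n \<le> 1 / lam N"
      using mn by (auto simp: lam_def intro!: divide_left_mono)
    have "(norm (E m x' t - E n x' t))\<^sup>2 \<le> 4 * (1 / lam m + 1 / lam n) * (norm y')\<^sup>2 * t"
      by (rule E_cauchy_estimate[OF x'(1) t0(1)])
    also have "\<dots> \<le> 4 * (1 / lam N + 1 / lam N) * (norm y')\<^sup>2 * \<bar>b\<bar>"
      using l t0 lam_pos[of m] lam_pos[of n] lam_pos[of N]
      by (intro mult_mono add_mono) (auto intro!: mult_nonneg_nonneg add_nonneg_nonneg)
    also have "\<dots> = c / lam N" by (simp add: c_def)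
    also have "\<dots> < (e / 4)\<^sup>2"
    proof -
      have "c / (e / 4)\<^sup>2 < lam N" using N N0 by linarith
      then show ?thesis using N0(1) e by (simp add: field_simps)
    qed
    finally have 1: "norm (E m x' t - E n x' t) < e / 4"
      by (rule power2_less_imp_less) (use e in simp)
    have "E m x t - E n x t = E m (x - x') t + (E m x' t - E n x' t) - E n (x - x') t"
      by (simp add: E_diff[OF t0(1)])
    also have "norm \<dots> \<le> norm (E m (x - x') t) + norm (E m x' t - E n x' t) + norm (E n (x - x') t)"
      by (rule order_trans[OF norm_triangle_ineq4 add_right_mono[OF norm_triangle_ineq]])
    also have "\<dots> < e"
      using 1 x'(2) E_contraction[OF t0(1), of m "x - x'"] E_contraction[OF t0(1), of n "x - x'"] e by linarith
    finally show ?thesis by (simp add: dist_norm)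
  qed
  then show "\<exists>M. \<forall>t\<in>{0..b}. \<forall>m\<ge>M. \<forall>n\<ge>M. dist (E m x t) (E n x t) < e" by blast
qed

definition "U t x = lim (\<lambda>n. E n x t)"

lemma E_uniform_limit: "uniform_limit {0..b} (\<lambda>n. E n x) (\<lambda>t. U t x) sequentially"
  unfolding U_def uniformly_convergent_uniform_limit_iff[symmetric]
  by (rule Cauchy_uniformly_convergent[OF E_uniformly_Cauchy])

lemma E_tendsto: "0 \<le> t \<Longrightarrow> (\<lambda>n. E n x t) \<longlonglongrightarrow> U t x"
  by (rule tendsto_uniform_limitI[OF E_uniform_limit[where b = t]]) simp

lemma U_norm: "0 \<le> t \<Longrightarrow> norm (U t x) \<le> norm x"
  by (rule LIMSEQ_le_const2[OF tendsto_norm[OF E_tendsto]]) (auto intro: E_contraction)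

lemma U_add: "0 \<le> t \<Longrightarrow> U t (x + y) = U t x + U t y"
  using tendsto_add[OF E_tendsto E_tendsto, of t t x y] E_tendsto[of t "x + y"]
  by (simp add: E_add[symmetric] LIMSEQ_unique)

lemma U_scaleC: "0 \<le> t \<Longrightarrow> U t (z *\<^sub>C x) = z *\<^sub>C U t x"
  using tendsto_scaleC[OF E_tendsto, of t z x] E_tendsto[of t "z *\<^sub>C x"]
  by (simp add: E_scaleC[symmetric] LIMSEQ_unique)

lemma U_0: "U 0 x = x"
  using E_tendsto[of 0 x] by (simp add: E_0 LIMSEQ_const_iff)

text \<open>In the semigroup law for \<open>E n\<close> the inner value may be replaced by its
  limit: by contractivity the error is at most norm (E n x t - U t x).\<close>

lemma U_semigroup:
  assumes "0 \<le> s" "0 \<le> t"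
  shows "U (s + t) x = U s (U t x)"
proof -
  have "(\<lambda>n. E n (E n x t - U t x) s) \<longlonglongrightarrow> 0"
  proof (rule Lim_null_comparison)
    show "(\<lambda>n. norm (E n x t - U t x)) \<longlonglongrightarrow> 0"
      using tendsto_norm[OF tendsto_diff[OF E_tendsto[OF assms(2)] tendsto_const], of x "U t x"] by simp
  qed (simp add: E_contraction[OF assms(1)])
  from tendsto_add[OF this E_tendsto[OF assms(1), of "U t x"]]
  have "(\<lambda>n. E n x (s + t)) \<longlonglongrightarrow> U s (U t x)"
    by (simp add: E_diff[OF assms(1)] E_semigroup[OF assms(1)])
  then show ?thesis using E_tendsto[of "s + t" x] assms LIMSEQ_unique by simp
qed

lemma U_continuous: "continuous_on {0..} (\<lambda>t. U t x)"
  unfolding continuous_on_eq_continuous_within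
proof
  fix t :: real assume t: "t \<in> {0..}"
  \<comment> \<open>The extra 1 makes the interval a neighbourhood of \<open>t\<close> within the
    half line.\<close>
  have "continuous_on {0..t + 1} (\<lambda>t. U t x)"
    by (rule uniform_limit_theorem[OF _ E_uniform_limit])
      (auto intro!: always_eventually continuous_at_imp_continuous_on has_vector_derivative_continuous[OF E_deriv])
  then have "continuous (at t within {0..t + 1}) (\<lambda>t. U t x)"
    using t by (auto simp: continuous_on_eq_continuous_within)
  moreover have "at t within {0..} = at t within {0..t + 1}"
    by (rule at_within_nhd[of t "{..<t + 1}"]) auto
  ultimately show "continuous (at t within {0..}) (\<lambda>t. U t x)" by simp
qed

lemma contraction_semigroup_U: "contraction_semigroup U"
  unfolding contraction_semigroup_def
proof (intro conjI allI impI)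
  fix t :: real assume t: "0 \<le> t"
  have "bounded_clinear (U t)"
    unfolding bounded_clinear_def
    by (auto intro!: bounded_linear_intro[of _ 1] simp: U_add[OF t] U_norm[OF t] U_scaleC[OF t] scaleR_scaleC)
  then show "(\<lambda>x. Some (U t x)) \<in> bounded_ops" by (simp add: bounded_ops_Some_iff)
  show "norm (U t x) \<le> norm x" for x by (rule U_norm[OF t])
qed (auto simp: U_0 U_semigroup U_continuous fun_eq_iff)

text \<open>The estimate is shown for \<open>E n\<close> and passed to the limit. The derivative E n
  (Y n x) s is close to U s y for large n, uniformly in s, and U s y is close to y for small s; the
  mean value inequality then bounds the deviation from the linear part.\<close>

lemma U_derivative_bound:
  assumes "e > 0" and xy: "G x = Some y"
  obtains \<delta> where "\<delta> > 0" "\<And>t. 0 \<le> t \<Longrightarrow> t \<le> \<delta> \<Longrightarrow> norm (U t x - x - t *\<^sub>R y) \<le> t * e"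
proof -
  \<comment> \<open>Four differences are estimated below, each by \<open>e'\<close>.\<close>
  define e' where "e' = e / 4"
  have e': "e' > 0" using assms(1) by (simp add: e'_def)
  have "continuous (at 0 within {0..}) (\<lambda>t. U t y)"
    using U_continuous[of y] by (auto simp: continuous_on_eq_continuous_within)
  then obtain d where d: "d > 0" "\<And>s. s \<in> {0..} \<Longrightarrow> dist s 0 < d \<Longrightarrow> dist (U s y) (U 0 y) < e'"
    unfolding continuous_within_eps_delta using e' by blast
  have bound: "norm (U t x - x - t *\<^sub>R y) \<le> t * e" if t: "0 \<le> t" "t \<le> d / 2" for t
  proof -
    have Yx: "(\<lambda>n. Y n x) \<longlonglongrightarrow> y" using J_tendsto[of y] by (simp add: Y_eq_J[OF xy])
    have "\<forall>\<^sub>F n in sequentially. norm (E n x t - x - t *\<^sub>R Y n x) \<le> t * e"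
      using uniform_limitD[OF E_uniform_limit[where b = t and x = y] e'] tendstoD[OF Yx e']
    proof eventually_elim
      case (elim n)
      have "norm (Y n (E n x s) - Y n (E n x 0)) \<le> e" if s: "s \<in> {0..t}" for s
      proof -
        have s0: "0 \<le> s" using s by simp
        have 1: "norm (E n (Y n x - y) s) < e'"
          using E_contraction[OF s0, of n "Y n x - y"] elim(2) by (simp add: dist_norm)
        have 2: "norm (E n y s - U s y) < e'" using elim(1) s by (simp add: dist_norm)
        have 3: "norm (U s y - y) < e'" using d(2)[of s] d(1) s t by (simp add: dist_norm U_0)
        have 4: "norm (y - Y n x) < e'" using elim(2) by (simp add: dist_norm norm_minus_commute)
        have "Y n (E n x s) - Y n (E n x 0) =
            (E n (Y n x - y) s + (E n y s - U s y)) + ((U s y - y) + (y - Y n x))"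
          by (simp add: Y_E[OF s0] E_0 E_diff[OF s0])
        also have "norm \<dots> \<le> (norm (E n (Y n x - y) s) + norm (E n y s - U s y))
            + (norm (U s y - y) + norm (y - Y n x))"
          by (intro norm_triangle_mono norm_triangle_ineq)
        also have "\<dots> \<le> e" using 1 2 3 4 by (simp add: e'_def)
        finally show ?thesis .
      qed
      then have "norm (E n x t - E n x 0 - (t - 0) *\<^sub>R Y n (E n x 0)) \<le> norm (t - 0) * e"
        using t(1) by (intro vector_differentiable_bound_linearization[of "{0..t}"])
          (auto simp: closed_segment_eq_real_ivl intro: has_vector_derivative_at_within E_deriv)
      then show ?case using t(1) by (simp add: E_0)
    qed
    moreover have "(\<lambda>n. norm (E n x t - x - t *\<^sub>R Y n x)) \<longlonglongrightarrow> norm (U t x - x - t *\<^sub>R y)"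
      by (intro tendsto_intros E_tendsto t Yx)
    ultimately show ?thesis by (intro tendsto_upperbound[OF _ _ sequentially_bot])
  qed
  show thesis by (rule that[of "d / 2"]) (use d(1) bound in auto)
qed

lemma U_derivative:
  assumes "G x = Some y"
  shows "((\<lambda>t. (U t x - x) /\<^sub>R t) \<longlongrightarrow> y) (at_right 0)"
proof (rule tendstoI)
  fix e :: real assume "e > 0"
  then obtain \<delta> where \<delta>: "\<delta> > 0" "\<And>t. 0 \<le> t \<Longrightarrow> t \<le> \<delta> \<Longrightarrow> norm (U t x - x - t *\<^sub>R y) \<le> t * (e / 2)"
    using U_derivative_bound[of "e / 2" x y] assms by auto
  have "dist ((U t x - x) /\<^sub>R t) y < e" if t: "0 < t" "t < \<delta>" for t
  proof -
    have "(U t x - x) /\<^sub>R t - y = (U t x - x - t *\<^sub>R y) /\<^sub>R t" using t by (simp add: scaleR_diff_right)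
    then have "dist ((U t x - x) /\<^sub>R t) y = norm (U t x - x - t *\<^sub>R y) / t"
      using t by (simp add: dist_norm divide_inverse mult.commute)
    also have "\<dots> \<le> e / 2" using \<delta>(2)[of t] t by (simp add: field_simps)
    also have "\<dots> < e" using \<open>e > 0\<close> by simp
    finally show ?thesis .
  qed
  then show "\<forall>\<^sub>F t in at_right 0. dist ((U t x - x) /\<^sub>R t) y < e"
    using \<delta>(1) by (auto simp: eventually_at_right_field)
qed

text \<open>The generator is dissipative and extends \<open>G\<close>, hence equals \<open>G\<close> by maximality.\<close>

lemma derivative_in_G:
  assumes lim: "((\<lambda>t. (U t x - x) /\<^sub>R t) \<longlongrightarrow> y) (at_right 0)"
  shows "G x = Some y"
proof -
  \<comment> \<open>Maximality supplies z in dom G with z - G z = x - y. The right derivative of the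
    orbit of w = x - z is then y - k = w itself, while contractivity makes its pairing with w
    nonpositive, so w = 0.\<close>
  obtain z k where z: "G z = Some k" "1 *\<^sub>R z - k = x - y" using range[of 1 "x - y"] by auto
  define w where "w = x - z"
  have wk: "w = y - k" using z(2) by (simp add: w_def algebra_simps)
  have "((\<lambda>t. (U t x - x) /\<^sub>R t - (U t z - z) /\<^sub>R t) \<longlongrightarrow> w) (at_right 0)"
    unfolding wk by (intro tendsto_diff lim U_derivative z)
  then have "((\<lambda>t. inner w ((U t x - x) /\<^sub>R t - (U t z - z) /\<^sub>R t)) \<longlongrightarrow> inner w w) (at_right 0)"
    by (intro tendsto_inner tendsto_const)
  moreover have "\<forall>\<^sub>F t in at_right 0. inner w ((U t x - x) /\<^sub>R t - (U t z - z) /\<^sub>R t) \<le> 0"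
  proof -
    have "inner w ((U t x - x) /\<^sub>R t - (U t z - z) /\<^sub>R t) \<le> 0" if t: "0 < t" for t
    proof -
      have Uw: "U t w = U t x - U t z"
        using U_add[of t x "- z"] U_scaleC[of t "-1" z] t by (simp add: w_def)
      have "(U t x - x) - (U t z - z) = U t w - w" unfolding Uw by (simp add: w_def)
      then have "(U t x - x) /\<^sub>R t - (U t z - z) /\<^sub>R t = (U t w - w) /\<^sub>R t"
        by (simp only: scaleR_diff_right[symmetric])
      moreover have "inner w (U t w) \<le> inner w w"
        using norm_cauchy_schwarz[of w "U t w"] mult_left_mono[OF U_norm[of t w], of "norm w"] t
        by (simp add: power2_norm_eq_inner[symmetric] power2_eq_square)
      ultimately show ?thesis using t by (simp add: inner_diff_right mult_le_0_iff divide_le_0_iff)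
    qed
    then show ?thesis by (auto simp: eventually_at_right_field intro: exI[of _ 1])
  qed
  ultimately have "inner w w \<le> 0" by (intro tendsto_upperbound) auto
  then have "w = 0" by (metis inner_gt_zero_iff not_less)
  then show ?thesis using z(1) wk by (simp add: w_def)
qed

lemma generates: "generates_contraction_semigroup G"
proof -
  have "generator U x = Some y \<longleftrightarrow> G x = Some y" for x y
  proof -
    have "generator U x = Some y \<longleftrightarrow> ((\<lambda>t. (U t x - x) /\<^sub>R t) \<longlongrightarrow> y) (at_right 0)"
      unfolding generator_def op_of_graph_eq_Some_iff
      by (auto intro: tendsto_unique[OF trivial_limit_at_right_real])
    then show ?thesis using U_derivative derivative_in_G by blast
  qed
  then have "generator U = G" by (rule op_eqI)
  then show ?thesis using contraction_semigroup_U by (auto simp: generates_contraction_semigroup_def)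
qed

end

section \<open>Range condition for i Q and generation by - i Q\<close>

context damped_op
begin

text \<open>At parameter 0 the lower bound is 1/b, with b a bound for \<open>Q_inv\<close>. At \<mu>
  > 0 accretivity provides the lower bound \<mu>, so surjectivity at \<mu> spreads to all \<nu>
  between 0 and 2 \<mu>, and geometric growth reaches every l.\<close>

lemma iQ_shift_surj:
  assumes "accretive R" "l > 0"
  shows "\<exists>f k. (\<i> *\<^sub>o Q) f = Some k \<and> l *\<^sub>R f + k = h"
proof -
  define T where "T = \<i> *\<^sub>o Q"
  define surj where "surj \<mu> \<longleftrightarrow> (\<forall>h. \<exists>f k. T f = Some k \<and> \<mu> *\<^sub>R f + k = h)" for \<mu>
  have linear: "linear_op T" unfolding T_def by (rule linear_op_scale[OF linear_Q])
  have T_iff: "T f = Some k \<longleftrightarrow> (\<exists>y. f = Q_inv y \<and> k = \<i> *\<^sub>C y)" for f k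
    by (auto simp: T_def op_scale_eq_Some_iff Q_eq_Some_iff)
  have accr: "0 \<le> inner f k" if "T f = Some k" for f k
    using accretive_iQ[OF assms(1)] that unfolding T_def accretive_def inner_Re_cinner
    by (metis domI option.sel)
  obtain b where b: "b > 0" "\<And>y. norm (Q_inv y) \<le> norm y * b"
    using bounded_Q_inv bounded_linear.pos_bounded unfolding bounded_clinear_def by blast
  have small: "surj \<nu>" if "0 < \<nu>" "\<nu> < 1 / b" for \<nu>
    unfolding surj_def
  proof
    fix h
    show "\<exists>f k. T f = Some k \<and> \<nu> *\<^sub>R f + k = h"
    proof (rule surj_shift[OF linear])
      show "\<exists>f k. T f = Some k \<and> 0 *\<^sub>R f + k = h'" for h'
      proof -
        have "h' = \<i> *\<^sub>C (- \<i>) *\<^sub>C h'" by (simp only: scaleC_scaleC) simp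
        then have "T (Q_inv ((- \<i>) *\<^sub>C h')) = Some h'" unfolding T_iff by blast
        moreover have "0 *\<^sub>R Q_inv ((- \<i>) *\<^sub>C h') + h' = h'"
          by (simp only: scaleR_zero_left add_0_left)
        ultimately show ?thesis by blast
      qed
      show "1 / b * norm f \<le> norm (0 *\<^sub>R f + k)" if "T f = Some k" for f k
        using that b by (auto simp: T_iff norm_scaleC field_simps)
      show "\<bar>\<nu> - 0\<bar> < 1 / b" using that by simp
    qed
  qed
  have step: "surj \<nu>" if "surj \<mu>" "0 < \<nu>" "\<nu> < 2 * \<mu>" for \<mu> \<nu>
    unfolding surj_def
  proof
    fix h
    show "\<exists>f k. T f = Some k \<and> \<nu> *\<^sub>R f + k = h"
    proof (rule surj_shift[OF linear])
      show "\<exists>f k. T f = Some k \<and> \<mu> *\<^sub>R f + k = h'" for h'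
        using that(1) unfolding surj_def by blast
      show "\<mu> * norm f \<le> norm (\<mu> *\<^sub>R f + k)" if "T f = Some k" for f k
      proof (cases "f = 0")
        case False
        have "norm f * (\<mu> * norm f) = \<mu> * inner f f"
          by (simp add: power2_norm_eq_inner[symmetric] power2_eq_square)
        also have "\<dots> \<le> inner f (\<mu> *\<^sub>R f + k)" using accr[OF that] by (simp add: inner_add_right)
        also have "\<dots> \<le> norm f * norm (\<mu> *\<^sub>R f + k)" by (rule norm_cauchy_schwarz)
        finally have "norm f * (\<mu> * norm f) \<le> norm f * norm (\<mu> *\<^sub>R f + k)" .
        with False show ?thesis by simp
      qed simp
      show "\<bar>\<nu> - \<mu>\<bar> < \<mu>" using that by linarith
    qed
  qed
  define l0 where "l0 = 1 / (2 * b)"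
  have l0: "l0 > 0" "l0 < 1 / b" using b(1) by (auto simp: l0_def field_simps)
  \<comment> \<open>Any ratio strictly between 1 and 2 is admissible for \<open>step\<close>. Once l
    is exceeded, one more use of \<open>step\<close> goes down to l.\<close>
  have "surj ((3/2) ^ n * l0)" for n
  proof (induction n)
    case (Suc n)
    show ?case by (rule step[OF Suc.IH]) (use l0 in auto)
  qed (use small[OF l0] in simp)
  moreover obtain n where "l / l0 < (3/2) ^ n" using real_arch_pow[of "3/2" "l / l0"] by auto
  then have "l < (3/2) ^ n * l0" using l0(1) by (simp only: pos_divide_less_eq)
  then have "l < 2 * ((3/2) ^ n * l0)" using assms(2) by linarith
  ultimately have "surj l" using step assms(2) by blast
  then show ?thesis unfolding surj_def T_def by blast
qed

lemma minus_iQ_generates: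
  assumes "accretive R"
  shows "generates_contraction_semigroup ((- \<i>) *\<^sub>o Q)"
proof -
  have G_iff: "((- \<i>) *\<^sub>o Q) f = Some k \<longleftrightarrow> (\<i> *\<^sub>o Q) f = Some (- k)" for f k
    by (auto simp: op_scale_eq_Some_iff) (metis minus_minus)
  interpret maximal_dissipative "(- \<i>) *\<^sub>o Q"
  proof
    show "linear_op ((- \<i>) *\<^sub>o Q)" by (rule linear_op_scale[OF linear_Q])
    have "dom ((- \<i>) *\<^sub>o Q) = dom Q" by (auto simp: op_scale_def dom_def)
    then show "densely_defined ((- \<i>) *\<^sub>o Q)" using densely_defined_Q by (simp add: densely_defined_def)
    show "inner f k \<le> 0" if "((- \<i>) *\<^sub>o Q) f = Some k" for f k
    proof -
      have "(\<i> *\<^sub>o Q) f = Some (- k)" using that by (simp only: G_iff)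
      then have "0 \<le> Re (cinner f (- k))"
        using accretive_iQ[OF assms] unfolding accretive_def by (metis domI option.sel)
      then show ?thesis by (simp add: inner_Re_cinner)
    qed
    show "\<exists>f k. ((- \<i>) *\<^sub>o Q) f = Some k \<and> l *\<^sub>R f - k = h" if "l > 0" for l h
    proof -
      obtain f k where "(\<i> *\<^sub>o Q) f = Some k" "l *\<^sub>R f + k = h" using iQ_shift_surj[OF assms \<open>l > 0\<close>] by blast
      then show ?thesis by (intro exI[of _ f] exI[of _ "- k"]) (simp add: G_iff)
    qed
  qed
  show ?thesis by (rule generates)
qed

end

theorem theorem4p3:
  fixes A :: "'h1::chilbert_space \<rightharpoonup> 'h2::chilbert_space"
    and R :: "'h1 \<rightharpoonup> 'h1"
    and \<epsilon> :: real
  assumes "separable_space (euclidean :: 'h1 topology)"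
    and "separable_space (euclidean :: 'h2 topology)"
    and "linear_op A" and "densely_defined A" and "closed_op A"
    and "\<epsilon> > 0" and "nonneg_op ((adj A \<circ>\<^sub>m A) -\<^sub>o complex_of_real \<epsilon> *\<^sub>o id_op)"
    and "linear_op R" and "densely_defined R" and "closable_op R"
    and "dom A \<subseteq> dom R"
  shows
    "let S = op_abs A; Q = Q_op S R; M = M_pencil S R in
      inj_on Q (dom Q) \<and> closed_op Q \<and>
      (\<forall>z\<in>resolvent_set Q.
        op_inv (Q -\<^sub>o z *\<^sub>o id_op) =
          block_op
            (z *\<^sub>o op_inv (M z))
            (op_inv S +\<^sub>o (op_inv (M z) \<circ>\<^sub>m ((\<i> * z) *\<^sub>o R +\<^sub>o z\<^sup>2 *\<^sub>o id_op) \<circ>\<^sub>m op_inv S))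
            (S \<circ>\<^sub>m op_inv (M z))
            (S \<circ>\<^sub>m op_inv (M z) \<circ>\<^sub>m (\<i> *\<^sub>o R +\<^sub>o z *\<^sub>o id_op) \<circ>\<^sub>m op_inv S)) \<and>
      resolvent_set Q = {\<zeta>. inj_on (M \<zeta>) (dom (M \<zeta>)) \<and> op_inv (M \<zeta>) \<in> bounded_ops} \<and>
      {\<zeta>. inj_on (M \<zeta>) (dom (M \<zeta>)) \<and> op_inv (M \<zeta>) \<in> bounded_ops} = pencil_resolvent_set M \<and>
      op_spectrum Q = pencil_spectrum M \<and>
      op_inv Q =
        block_op zero_op (op_inv S) (op_inv S) (\<i> *\<^sub>o (op_inv S \<circ>\<^sub>m R \<circ>\<^sub>m op_inv S)) \<and>
      op_inv Q \<in> bounded_ops \<and>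
      0 \<in> resolvent_set Q \<and>
      (accretive R \<longrightarrow>
        accretive (\<i> *\<^sub>o Q) \<and> generates_contraction_semigroup ((- \<i>) *\<^sub>o Q))"
proof -
  interpret dense_closed_op A by unfold_locales (rule assms)+
  interpret coercive_op A \<epsilon> by unfold_locales (use assms AA_def in simp_all)
  obtain C where C: "positive_inverse (op_abs A) C" "\<And>f k. AA f = Some k \<longleftrightarrow> f = C (C k)"
    by (rule abs_inverse) (rule that)
  interpret damped_op "op_abs A" C R
    using C(1) dom_abs_subset assms by (simp add: damped_op_def damped_op_axioms_def)
  have pencil: "{\<zeta>. inj_on (M \<zeta>) (dom (M \<zeta>)) \<and> op_inv (M \<zeta>) \<in> bounded_ops} = pencil_resolvent_set M"
    by (simp add: pencil_resolvent_set_def resolvent_set_def)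
  have "op_spectrum Q = pencil_spectrum M"
    using resolvent_set_Q pencil
    by (auto simp: op_spectrum_def pencil_spectrum_def pencil_resolvent_set_def)
  moreover have "inj_on Q (dom Q)" by (rule inj_on_dom_if_inverse[OF Q_eq_Some_iff])
  moreover have "op_inv Q \<in> bounded_ops" by (simp add: op_inv_Q bounded_ops_Some_iff bounded_Q_inv)
  ultimately show ?thesis
    unfolding Let_def
    using pencil closed_Q op_inv_Q_shift resolvent_set_Q op_inv_Q_block zero_in_resolvent_set_Q
      accretive_iQ minus_iQ_generates
    by (intro conjI ballI impI) blast+
qed

end
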